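(* Let $p\in(1,\infty)$, let $(\mu_t)_{t\ge0}$ be the marginal laws of an $\mathbb{R}^d$-valued Lévy process starting in $0$ with $\int_{\mathbb{R}^d}|x|^p\,\mu_1(dx)<\infty$, and let $\varphi\colon[0,+\infty)\to[0,+\infty]$ be lower semicontinuous, convex, increasing, not constant, with $\varphi(0)=0$ and such that $x\mapsto\varphi(x^{1/p})$ is convex on $[0,\infty)$. Let $A^\mu$, with domain $D(A^\mu)$, be the generator of the Lévy process, and let $\mathscr{S}(t)$, $t\ge0$, be the operators on $C_0(\mathbb{R}^d)$ defined in the context. Then for every $f\in D(A^\mu)\cap C_0^1(\mathbb{R}^d)$, $$\mathscr{A}f:=\lim_{t\downarrow0}\frac{\mathscr{S}(t)f-f}{t}=A^\mu f+\varphi^\ast(|\nabla f|),$$ and the limit is uniform (over $x\in\mathbb{R}^d$), where $\varphi^\ast(y):=\sup_{x\ge0}(xy-\varphi(x))$ for $y\ge0$.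
   Context: "Increasing" is in the weak sense (nondecreasing). $|\cdot|$ is the Euclidean norm. $\mathcal{P}_p(\mathbb{R}^d)$ is the set of Borel probability measures on $\mathbb{R}^d$ with finite $p$-th moment, and $\mathcal{W}_p(\mu,\nu)=\inf_\gamma\big(\int|y-x|^p\,\gamma(dx,dy)\big)^{1/p}$, the infimum being over all couplings $\gamma$ of $\mu$ and $\nu$. $C_0(\mathbb{R}^d)$ is the space of real-valued continuous functions on $\mathbb{R}^d$ vanishing at infinity, with the supremum norm $\|\cdot\|_\infty$. $C^1_0(\mathbb{R}^d)$ is the space of continuously differentiable $f\in C_0(\mathbb{R}^d)$ whose gradient vanishes at infinity. $A^\mu$ is the infinitesimal generator of the Feller semigroup $S^\mu(t)f(x):=\int_{\mathbb{R}^d}f(x+y)\,\mu_t(dy)$ on $C_0(\mathbb{R}^d)$, i.e. $A^\mu f=\lim_{t\downarrow0}(S^\mu(t)f-f)/t$ in supremum norm, with $D(A^\mu)$ the set of $f\in C_0(\mathbb{R}^d)$ for which this limit exists. Set $\varphi_t(a):=t\varphi(a/t)$ for $t>0$, $\varphi_0(0):=0$ and $\varphi_0(a):=+\infty$ for $a>0$. For $t\ge0$, $f\in C_0(\mathbb{R}^d)$, $x\in\mathbb{R}^d$, $$S(t)f(x):=\sup_{\nu\in\mathcal{P}_p(\mathbb{R}^d)}\Big(\int_{\mathbb{R}^d}f(x+y)\,\nu(dy)-\varphi_t(\mathcal{W}_p(\mu_t,\nu))\Big).$$ Each $S(t)$ maps $C_0(\mathbb{R}^d)$ to itself. For $n\in\mathbb{N}$,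 $t\ge0$ let $k=\lfloor2^nt\rfloor$, $t_n=k2^{-n}$, and $\mathscr{S}^n(t):=S(2^{-n})\circ\cdots\circ S(2^{-n})\circ S(t-t_n)$ with $k$ factors $S(2^{-n})$. Finally $\mathscr{S}(t)f:=\lim_{n\to\infty}\mathscr{S}^n(t)f$ (pointwise; the limit exists and lies in $C_0(\mathbb{R}^d)$). *)

theory Defs
  imports "HOL-Probability.Probability"
begin

section \<open>Levy processes\<close>

text \<open>
  Stochastic continuity is required in place of cadlag paths. Cadlag paths and stationary
  increments imply stochastic continuity, and a stochastically continuous process has a cadlag
  modification, so both conventions give the same families of marginal laws. Only the times
  \<open>t \<ge> 0\<close> are relevant.
\<close>

locale levy_process = prob_space M
  for M :: "'w measure" and X :: "real \<Rightarrow> 'w \<Rightarrow> 'a::euclidean_space" +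
  assumes random_variable_X: "\<And>t. 0 \<le> t \<Longrightarrow> random_variable borel (X t)"
    and starts_at_0: "AE \<omega> in M. X 0 \<omega> = 0"
    and independent_increments:
      "\<And>(n::nat) (\<tau>::nat \<Rightarrow> real). 0 \<le> \<tau> 0 \<Longrightarrow> strict_mono_on {..n} \<tau> \<Longrightarrow>
         indep_vars (\<lambda>_. borel) (\<lambda>i \<omega>. X (\<tau> (Suc i)) \<omega> - X (\<tau> i) \<omega>) {..<n}"
    and stationary_increments:
      "\<And>s t. 0 \<le> s \<Longrightarrow> 0 \<le> t \<Longrightarrow>
         distr M borel (\<lambda>\<omega>. X (s + t) \<omega> - X s \<omega>) = distr M borel (X t)"
    and stochastically_continuous:
      "\<And>t \<epsilon>. 0 \<le> t \<Longrightarrow> 0 < \<epsilon> \<Longrightarrow>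
         ((\<lambda>s. prob {\<omega> \<in> space M. \<epsilon> < norm (X s \<omega> - X t \<omega>)}) \<longlongrightarrow> 0) (at t within {0..})"


section \<open>Extended real valued functions on the half-line\<close>

definition ereal_convex_on :: "real set \<Rightarrow> (real \<Rightarrow> ereal) \<Rightarrow> bool" where
  "ereal_convex_on C h \<longleftrightarrow> convex C \<and>
     (\<forall>x\<in>C. \<forall>y\<in>C. \<forall>u\<ge>0. \<forall>v\<ge>0. u + v = 1 \<longrightarrow>
        h (u * x + v * y) \<le> ereal u * h x + ereal v * h y)"

definition lower_semicontinuous_on :: "real set \<Rightarrow> (real \<Rightarrow> ereal) \<Rightarrow> bool" where
  "lower_semicontinuous_on C h \<longleftrightarrow> (\<forall>x\<in>C. h x \<le> Liminf (at x within C) h)"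

text \<open>
  The conjugate is converted to a real number where it is used as a real-valued function. This
  loses nothing when \<open>\<phi>\<close> is increasing and not constant with \<open>\<phi> 0 = 0\<close>, and \<open>x \<mapsto> \<phi> (x powr (1 / p))\<close>
  is convex with \<open>p > 1\<close>: then \<open>\<phi>\<close> grows at least like a positive multiple of \<open>x powr p\<close>, so the
  conjugate is finite on the half-line.
\<close>

definition conjugate_fun :: "(real \<Rightarrow> ereal) \<Rightarrow> real \<Rightarrow> ereal" where
  "conjugate_fun \<phi> y = (SUP x\<in>{0..}. ereal (x * y) - \<phi> x)"

definition perspective :: "(real \<Rightarrow> ereal) \<Rightarrow> real \<Rightarrow> real \<Rightarrow> ereal" where
  "perspective \<phi> t a =
     (if 0 < t then ereal t * \<phi> (a / t) else if a = 0 then 0 else \<infinity>)"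


section \<open>Function spaces\<close>

definition C0 :: "('a::euclidean_space \<Rightarrow> real) set" where
  "C0 = {f. continuous_on UNIV f \<and> (f \<longlongrightarrow> 0) at_infinity}"

definition grad :: "('a::euclidean_space \<Rightarrow> real) \<Rightarrow> 'a \<Rightarrow> 'a" where
  "grad f x = (THE D. GDERIV f x :> D)"

definition C01 :: "('a::euclidean_space \<Rightarrow> real) set" where
  "C01 = {f \<in> C0. (\<forall>x. \<exists>D. GDERIV f x :> D) \<and>
            continuous_on UNIV (grad f) \<and> (grad f \<longlongrightarrow> 0) at_infinity}"


section \<open>The Feller semigroup and its generator\<close>

definition levy_semigroup ::
    "(real \<Rightarrow> 'a::euclidean_space measure) \<Rightarrow> real \<Rightarrow> ('a \<Rightarrow> real) \<Rightarrow> 'a \<Rightarrow> real" where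
  "levy_semigroup \<mu> t f x = (\<integral>y. f (x + y) \<partial>\<mu> t)"

text \<open>Convergence in supremum norm is expressed by \<^const>\<open>uniform_limit\<close> on \<^const>\<open>UNIV\<close>.\<close>

definition has_generator_value ::
    "(real \<Rightarrow> 'a::euclidean_space measure) \<Rightarrow> ('a \<Rightarrow> real) \<Rightarrow> ('a \<Rightarrow> real) \<Rightarrow> bool" where
  "has_generator_value \<mu> f g \<longleftrightarrow> f \<in> C0 \<and> g \<in> C0 \<and>
     uniform_limit UNIV (\<lambda>t x. (levy_semigroup \<mu> t f x - f x) / t) g (at_right 0)"

definition generator_domain ::
    "(real \<Rightarrow> 'a::euclidean_space measure) \<Rightarrow> ('a \<Rightarrow> real) set" where
  "generator_domain \<mu> = {f. \<exists>g. has_generator_value \<mu> f g}"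

definition generator ::
    "(real \<Rightarrow> 'a::euclidean_space measure) \<Rightarrow> ('a \<Rightarrow> real) \<Rightarrow> 'a \<Rightarrow> real" where
  "generator \<mu> f = (THE g. has_generator_value \<mu> f g)"


section \<open>Wasserstein distance\<close>

definition prob_moment :: "real \<Rightarrow> 'a::euclidean_space measure set" where
  "prob_moment p =
     {\<nu>. prob_space \<nu> \<and> sets \<nu> = sets borel \<and> integrable \<nu> (\<lambda>x. norm x powr p)}"

definition couplings ::
    "'a::euclidean_space measure \<Rightarrow> 'a measure \<Rightarrow> ('a \<times> 'a) measure set" where
  "couplings \<mu> \<nu> =
     {\<gamma>. prob_space \<gamma> \<and> sets \<gamma> = sets (borel \<Otimes>\<^sub>M borel) \<and>
         distr \<gamma> borel fst = \<mu> \<and> distr \<gamma> borel snd = \<nu>}"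

text \<open>
  Meant for two measures with finite \<open>p\<close>-th moment, \<open>p > 1\<close>: then every coupling
  has finite cost, and the Bochner integral below is the transport cost.
\<close>

definition wasserstein ::
    "real \<Rightarrow> 'a::euclidean_space measure \<Rightarrow> 'a measure \<Rightarrow> real" where
  "wasserstein p \<mu> \<nu> =
     (INF \<gamma>\<in>couplings \<mu> \<nu>. (\<integral>z. norm (snd z - fst z) powr p \<partial>\<gamma>) powr (1 / p))"


section \<open>The perturbed semigroup\<close>

text \<open>
  For \<open>f\<close> vanishing at infinity the supremum is finite: it is at most the supremum norm of
  \<open>f\<close>, and \<open>\<nu> = \<mu> t\<close> (which inherits the finite \<open>p\<close>-th moment from \<open>\<mu> 1\<close>) gives at least
  its negative.
\<close>

definition pert ::
    "real \<Rightarrow> (real \<Rightarrow> ereal) \<Rightarrow> (real \<Rightarrow> 'a::euclidean_space measure) \<Rightarrow>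
     real \<Rightarrow> ('a \<Rightarrow> real) \<Rightarrow> 'a \<Rightarrow> real" where
  "pert p \<phi> \<mu> t f x =
     real_of_ereal (SUP \<nu>\<in>prob_moment p.
       ereal (\<integral>y. f (x + y) \<partial>\<nu>) - perspective \<phi> t (wasserstein p (\<mu> t) \<nu>))"

definition pert_iter ::
    "real \<Rightarrow> (real \<Rightarrow> ereal) \<Rightarrow> (real \<Rightarrow> 'a::euclidean_space measure) \<Rightarrow>
     nat \<Rightarrow> real \<Rightarrow> ('a \<Rightarrow> real) \<Rightarrow> 'a \<Rightarrow> real" where
  "pert_iter p \<phi> \<mu> n t f =
     (let k = nat \<lfloor>2 ^ n * t\<rfloor>; t\<^sub>n = real k / 2 ^ n
      in (pert p \<phi> \<mu> (1 / 2 ^ n) ^^ k) (pert p \<phi> \<mu> (t - t\<^sub>n) f))"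

definition pert_semigroup ::
    "real \<Rightarrow> (real \<Rightarrow> ereal) \<Rightarrow> (real \<Rightarrow> 'a::euclidean_space measure) \<Rightarrow>
     real \<Rightarrow> ('a \<Rightarrow> real) \<Rightarrow> 'a \<Rightarrow> real" where
  "pert_semigroup p \<phi> \<mu> t f x = lim (\<lambda>n. pert_iter p \<phi> \<mu> n t f x)"

end

(* Writing S(t) for the one-step operator, Minkowski's inequality, Jensen's inequality and the
   convexity of the perspective give S(s) S(t) <= S(s + t): near-optimal second steps are chosen
   piecewise constantly in the first step, which avoids any measurable selection. Hence the dyadic
   iterates decrease in n, the limit exists and lies below S(t).

   The upper bound is thus a bound for a single step. For a coupling of mu_t and nu at distance w,
   the gain over the Levy semigroup is at most w (|grad f x| + o(1)) + C w^p, and phi grows at least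
   like a multiple of x^p, so only w = O(t) matters and the supremum is at most
   t (phi^*(|grad f x|) + o(1)). For the lower bound one translates mu_t by t b, with b in the
   direction of grad f x. This costs at most t phi(|b|), survives the iteration because mu is a
   convolution semigroup, and gains t <b, grad f x> to first order. *)

theory Submission
  imports Defs
begin

text \<open>A coupling controls only integrals of \<open>p\<close>-th powers of displacements,
  whereas Minkowski's inequality and the expansion of \<open>f\<close> concern the displacements
  themselves. Each estimate is therefore first made affine in such powers, pointwise and with the
  target distances as parameters, and then integrated. Couplings and laws are chosen near-optimal
  only; the errors are removed at the end. The exponent enters the penalty twice. A randomly chosen
  second step costs the \<open>p\<close>-mean of its conditional distances, and convexity of
  \<open>x \<mapsto> \<phi> (x powr (1 / p))\<close> compares this with the mean penalty; the same
  convexity yields the growth of \<open>\<phi>\<close>. The obstacle in the upper bound is the mass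
  of \<open>\<mu> t\<close> away from the origin: it is small, but its displacement is unbounded and
  the gradient at \<open>x\<close> gives no slope there. Cutting the displacement at
  \<open>K\<close> times the distance, with \<open>K\<close> fixed before \<open>t\<close> tends to
  0, turns it into a small error in the slope. Uniformity in \<open>x\<close> comes from using only
  global bounds and moduli of continuity of \<open>f\<close> and its derivatives.\<close>

section \<open>Powers of sums and uniform continuity\<close>

text \<open>Minkowski's inequality in pointwise form: \<open>(u + v) / (A + B)\<close> is the convex
  combination of \<open>u / A\<close> and \<open>v / B\<close> with weights proportional to
  \<open>A\<close> and \<open>B\<close>. If \<open>u powr p\<close> and \<open>v powr p\<close>
  integrate to at most \<open>A powr p\<close> and \<open>B powr p\<close>, the right-hand side
  integrates to at most \<open>(A + B) powr p\<close>. The case \<open>A = B = 1\<close> serves for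
  moments of sums.\<close>

lemma powr_convex_combination:
  fixes u v A B p :: real
  assumes "1 \<le> p" "0 \<le> u" "0 \<le> v" "0 < A" "0 < B"
  shows "(u + v) powr p \<le> (A + B) powr p * (A / (A + B) * (u powr p / A powr p) + B / (A + B) * (v powr p / B powr p))"
proof -
  let ?a = "A / (A + B)" and ?b = "B / (A + B)"
  have ab: "0 < ?a" "0 < ?b" "?a \<le> 1" "?b \<le> 1" "?a + ?b = 1"
    using assms add_divide_distrib[of A B "A + B"] by auto
  have sum: "?a * (u / A) + ?b * (v / B) = (u + v) / (A + B)"
    using assms by (simp add: add_divide_distrib)
  have pow_le: "(c * x) powr p \<le> c * x powr p" if "0 < c" "c \<le> 1" "0 \<le> x" for c x :: real
    using that assms(1) powr_mono'[of 1 p c] by (auto simp: powr_mult intro!: mult_right_mono)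
  have "((u + v) / (A + B)) powr p \<le> ?a * (u / A) powr p + ?b * (v / B) powr p"
  \<comment> \<open>Convexity of the power is applied on the open half-line; a vanishing summand is
    treated by \<open>c powr p \<le> c\<close> for \<open>c \<le> 1\<close>.\<close>
  proof (cases "u = 0 \<or> v = 0")
    case True
    then consider "u = 0" | "v = 0" by auto
    then show ?thesis
    proof cases
      case 1
      with pow_le[of ?b "v / B"] ab assms show ?thesis by (simp flip: sum)
    next
      case 2
      with pow_le[of ?a "u / A"] ab assms show ?thesis by (simp flip: sum)
    qed
  next
    case False
    then have "u / A \<in> {0<..}" "v / B \<in> {0<..}" using assms by auto
    from convex_onD[OF powr_convex[OF assms(1)], of ?b, OF _ _ this] ab(2,4)
    have "((1 - ?b) * (u / A) + ?b * (v / B)) powr p \<le> (1 - ?b) * (u / A) powr p + ?b * (v / B) powr p"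
      by simp
    moreover have "1 - ?b = ?a" using ab(5) by linarith
    ultimately show ?thesis by (simp only: sum)
  qed
  then have "(A + B) powr p * ((u + v) / (A + B)) powr p
      \<le> (A + B) powr p * (?a * (u / A) powr p + ?b * (v / B) powr p)"
    by (intro mult_left_mono) auto
  then show ?thesis
    using assms by (simp add: powr_divide)
qed

text \<open>Young's inequality for the product of \<open>u / w\<close> and 1, that is, the tangent
  at \<open>u = w\<close> of the concave map taking \<open>u powr p\<close> to \<open>u\<close>. If
  \<open>u powr p\<close> has mean at most \<open>w powr p\<close>, averaging shows that
  \<open>u\<close> has mean at most \<open>w\<close>.\<close>

lemma le_powr_tangent:
  fixes u w p :: real
  assumes "1 < p" "0 \<le> u" "0 < w"
  shows "u \<le> (1 - 1 / p) * w + w / p * (u powr p / w powr p)"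
proof -
  have "(u / w) * 1 \<le> (u / w) powr p / p + 1 powr (p / (p - 1)) / (p / (p - 1))"
    using assms by (intro Youngs_inequality) (auto simp: field_simps)
  then have "w * (u / w) \<le> w * ((u / w) powr p / p + 1 / (p / (p - 1)))"
    using assms by (intro mult_left_mono) auto
  then show ?thesis using assms by (simp add: powr_divide field_simps)
qed

lemma tail_le_powr:
  fixes u r p :: real
  assumes "1 \<le> p" "0 < r" "r \<le> u"
  shows "u \<le> u powr p / r powr (p - 1)"
proof -
  have "u * r powr (p - 1) \<le> u * u powr (p - 1)"
    using assms by (intro mult_left_mono powr_mono2) auto
  also have "\<dots> = u powr p"
    using assms powr_mult_base[of u "p - 1"] by simp
  finally show ?thesis using assms by (simp add: field_simps)
qed

lemma uniformly_continuous_vanishing_at_infinity: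
  fixes h :: "'a::euclidean_space \<Rightarrow> 'b::real_normed_vector"
  assumes cont: "continuous_on UNIV h" and lim: "(h \<longlongrightarrow> 0) at_infinity"
  shows "uniformly_continuous_on UNIV h"
  unfolding uniformly_continuous_on_def
proof (intro allI impI)
  fix e :: real assume e: "0 < e"
  from lim e have "\<forall>\<^sub>F x in at_infinity. norm (h x) < e / 2"
    using tendstoD[OF lim, of "e / 2"] by (simp add: dist_norm)
  then obtain b where b: "\<And>x. b \<le> norm x \<Longrightarrow> norm (h x) < e / 2"
    unfolding eventually_at_infinity by auto
  have "uniformly_continuous_on (cball 0 (b + 1)) h"
    by (intro compact_uniformly_continuous continuous_on_subset[OF cont]) auto
  then obtain d where d: "d > 0" "\<And>x y. \<lbrakk>x \<in> cball 0 (b + 1); y \<in> cball 0 (b + 1); dist y x < d\<rbrakk> \<Longrightarrow> dist (h y) (h x) < e"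
    using e unfolding uniformly_continuous_on_def by metis
  \<comment> \<open>The cap 1 puts both points into the larger ball as soon as one of them has norm
    at most \<open>b\<close>.\<close>
  have "dist (h y) (h x) < e" if xy: "dist y x < min d 1" for x y
  proof (cases "norm x \<le> b \<or> norm y \<le> b")
    case True
    have "norm x \<le> norm y + dist y x" "norm y \<le> norm x + dist y x"
      by (metis dist_norm norm_triangle_sub dist_commute)+
    then show ?thesis using True xy by (intro d) auto
  next
    case False
    then have "norm (h x) < e / 2" "norm (h y) < e / 2" using b[of x] b[of y] by linarith+
    then show ?thesis unfolding dist_norm using norm_triangle_ineq4[of "h y" "h x"] by linarith
  qed
  then show "\<exists>d>0. \<forall>x\<in>UNIV. \<forall>x'\<in>UNIV. dist x' x < d \<longrightarrow> dist (h x') (h x) < e"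
    using d(1) by (intro exI[of _ "min d 1"]) auto
qed

lemma bounded_range_vanishing_at_infinity:
  fixes h :: "'a::euclidean_space \<Rightarrow> 'b::real_normed_vector"
  assumes cont: "continuous_on UNIV h" and lim: "(h \<longlongrightarrow> 0) at_infinity"
  shows "bounded (range h)"
proof -
  have "\<forall>\<^sub>F x in at_infinity. norm (h x) < 1"
    using tendstoD[OF lim, of 1] by (simp add: dist_norm)
  then obtain b where b: "\<And>x. b \<le> norm x \<Longrightarrow> norm (h x) < 1"
    unfolding eventually_at_infinity by auto
  have "bounded (h ` cball 0 b)"
    by (intro compact_imp_bounded compact_continuous_image continuous_on_subset[OF cont]) auto
  moreover have "bounded (h ` (- cball 0 b))"
    by (intro boundedI[of _ 1]) (use b in \<open>auto intro!: less_imp_le\<close>)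
  ultimately have "bounded (h ` cball 0 b \<union> h ` (- cball 0 b))" by simp
  then show ?thesis by (metis Compl_partition image_Un)
qed

section \<open>Couplings\<close>

lemma couplingsD:
  assumes "\<gamma> \<in> couplings \<mu> \<nu>"
  shows "prob_space \<gamma>" "sets \<gamma> = sets (borel \<Otimes>\<^sub>M borel)" "distr \<gamma> borel fst = \<mu>" "distr \<gamma> borel snd = \<nu>"
  using assms by (auto simp: couplings_def)

lemma prob_momentD:
  assumes "\<nu> \<in> prob_moment p"
  shows "prob_space \<nu>" "sets \<nu> = sets borel" "integrable \<nu> (\<lambda>x. norm x powr p)"
  using assms by (auto simp: prob_moment_def)

lemma integral_coupling_fst:
  fixes g :: "'a::euclidean_space \<Rightarrow> real"
  assumes "\<gamma> \<in> couplings \<mu> \<nu>" and g: "g \<in> borel_measurable borel"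
  shows "(\<integral>z. g (fst z) \<partial>\<gamma>) = (\<integral>y. g y \<partial>\<mu>)" "integrable \<gamma> (\<lambda>z. g (fst z)) \<longleftrightarrow> integrable \<mu> g"
proof -
  note c = couplingsD[OF assms(1)]
  note [measurable_cong] = c(2)
  show "(\<integral>z. g (fst z) \<partial>\<gamma>) = (\<integral>y. g y \<partial>\<mu>)" "integrable \<gamma> (\<lambda>z. g (fst z)) \<longleftrightarrow> integrable \<mu> g"
    unfolding c(3)[symmetric] using g by (subst integral_distr integrable_distr_eq; simp)+
qed

lemma integral_coupling_snd:
  fixes g :: "'a::euclidean_space \<Rightarrow> real"
  assumes "\<gamma> \<in> couplings \<mu> \<nu>" and g: "g \<in> borel_measurable borel"
  shows "(\<integral>z. g (snd z) \<partial>\<gamma>) = (\<integral>y. g y \<partial>\<nu>)" "integrable \<gamma> (\<lambda>z. g (snd z)) \<longleftrightarrow> integrable \<nu> g"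
proof -
  note c = couplingsD[OF assms(1)]
  note [measurable_cong] = c(2)
  show "(\<integral>z. g (snd z) \<partial>\<gamma>) = (\<integral>y. g y \<partial>\<nu>)" "integrable \<gamma> (\<lambda>z. g (snd z)) \<longleftrightarrow> integrable \<nu> g"
    unfolding c(4)[symmetric] using g by (subst integral_distr integrable_distr_eq; simp)+
qed

text \<open>The two marginal moments dominate the cost. Integrability matters because a
  non-integrable cost would have Bochner integral 0 and make the transport look free.\<close>

lemma coupling_cost_integrable:
  fixes \<mu> \<nu> :: "'a::euclidean_space measure"
  assumes p: "1 \<le> p" and m: "\<mu> \<in> prob_moment p" "\<nu> \<in> prob_moment p" and g: "\<gamma> \<in> couplings \<mu> \<nu>"
  shows "integrable \<gamma> (\<lambda>z. norm (snd z - fst z) powr p)"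
proof -
  note c = couplingsD[OF g]
  have [measurable_cong]: "sets \<gamma> = sets (borel \<Otimes>\<^sub>M borel)" by (fact c)
  have int: "integrable \<gamma> (\<lambda>z. norm (fst z) powr p)" "integrable \<gamma> (\<lambda>z. norm (snd z) powr p)"
    using integral_coupling_fst(2)[OF g, of "\<lambda>x. norm x powr p"]
      integral_coupling_snd(2)[OF g, of "\<lambda>x. norm x powr p"] prob_momentD(3)[OF m(1)] prob_momentD(3)[OF m(2)]
    by auto
  show ?thesis
  proof (rule Bochner_Integration.integrable_bound)
    show "integrable \<gamma> (\<lambda>z. 2 powr p * (1/2 * norm (snd z) powr p + 1/2 * norm (fst z) powr p))"
      using int by auto
    show "AE z in \<gamma>. norm (norm (snd z - fst z) powr p)
        \<le> norm (2 powr p * (1/2 * norm (snd z) powr p + 1/2 * norm (fst z) powr p))"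
    proof (rule AE_I2)
      fix z
      have "norm (snd z - fst z) powr p \<le> (norm (snd z) + norm (fst z)) powr p"
        using p by (intro powr_mono2 norm_triangle_ineq4) auto
      also have "\<dots> \<le> 2 powr p * (1/2 * norm (snd z) powr p + 1/2 * norm (fst z) powr p)"
        using powr_convex_combination[of p "norm (snd z)" "norm (fst z)" 1 1] p by simp
      finally show "norm (norm (snd z - fst z) powr p)
        \<le> norm (2 powr p * (1/2 * norm (snd z) powr p + 1/2 * norm (fst z) powr p))" by simp
    qed
  qed measurable
qed

text \<open>Makes the set of couplings non-empty, which the real-valued \<open>INF\<close> in
  \<open>wasserstein\<close> requires before lower bounds and near-optimal elements are
  available.\<close>

lemma pair_measure_coupling:
  fixes \<mu> \<nu> :: "'a::euclidean_space measure"
  assumes "prob_space \<mu>" "prob_space \<nu>" and s: "sets \<mu> = sets borel" "sets \<nu> = sets borel"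
  shows "\<mu> \<Otimes>\<^sub>M \<nu> \<in> couplings \<mu> \<nu>"
proof -
  interpret M: prob_space \<mu> by fact
  interpret N: prob_space \<nu> by fact
  interpret P: pair_prob_space \<mu> \<nu> by unfold_locales
  have "distr (\<mu> \<Otimes>\<^sub>M \<nu>) borel fst = \<mu>"
    using N.distr_pair_fst[of \<mu>] s(1) distr_cong[OF refl s(1), of "\<mu> \<Otimes>\<^sub>M \<nu>" fst fst] by simp
  moreover have "distr (\<mu> \<Otimes>\<^sub>M \<nu>) borel snd = \<nu>"
  proof (rule measure_eqI)
    fix A assume "A \<in> sets (distr (\<mu> \<Otimes>\<^sub>M \<nu>) borel snd)"
    then have A: "A \<in> sets borel" by simp
    have "emeasure (distr (\<mu> \<Otimes>\<^sub>M \<nu>) borel snd) A = emeasure (\<mu> \<Otimes>\<^sub>M \<nu>) (space \<mu> \<times> A)"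
      using A s sets.sets_into_space[OF A[folded s(2)]]
      by (subst emeasure_distr)
         (auto simp: space_pair_measure cong: measurable_cong_sets intro!: arg_cong2[where f=emeasure])
    also have "\<dots> = emeasure \<nu> A"
      using A s by (subst N.emeasure_pair_measure_Times) (auto simp: M.emeasure_space_1)
    finally show "emeasure (distr (\<mu> \<Otimes>\<^sub>M \<nu>) borel snd) A = emeasure \<nu> A" .
  qed (simp add: s)
  moreover have "sets (\<mu> \<Otimes>\<^sub>M \<nu>) = sets (borel \<Otimes>\<^sub>M borel)" using s by (intro sets_pair_measure_cong)
  ultimately show ?thesis unfolding couplings_def using P.prob_space_axioms by auto
qed

section \<open>Bounds for the Wasserstein distance\<close>

lemma wasserstein_bdd_below:
  "bdd_below ((\<lambda>\<gamma>. (\<integral>z. norm (snd z - fst z) powr p \<partial>\<gamma>) powr (1 / p)) ` couplings \<mu> \<nu>)"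
  by (rule bdd_belowI[of _ 0]) auto

lemma wasserstein_le:
  fixes \<mu> \<nu> :: "'a::euclidean_space measure"
  assumes p: "1 \<le> p" and g: "\<gamma> \<in> couplings \<mu> \<nu>" and w: "0 \<le> w"
    and le: "(\<integral>z. norm (snd z - fst z) powr p \<partial>\<gamma>) \<le> w powr p"
  shows "wasserstein p \<mu> \<nu> \<le> w"
proof -
  have "wasserstein p \<mu> \<nu> \<le> (\<integral>z. norm (snd z - fst z) powr p \<partial>\<gamma>) powr (1 / p)"
    unfolding wasserstein_def by (rule cINF_lower[OF wasserstein_bdd_below g])
  also have "\<dots> \<le> (w powr p) powr (1 / p)"
    using p le by (intro powr_mono2) auto
  also have "\<dots> = w" using p w by (simp add: powr_powr)
  finally show ?thesis .
qed

lemma wasserstein_nonneg: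
  fixes \<mu> \<nu> :: "'a::euclidean_space measure"
  assumes "\<mu> \<in> prob_moment p" "\<nu> \<in> prob_moment p"
  shows "0 \<le> wasserstein p \<mu> \<nu>"
  unfolding wasserstein_def
  by (rule cINF_greatest)
     (use pair_measure_coupling[of \<mu> \<nu>] prob_momentD[OF assms(1)] prob_momentD[OF assms(2)] in auto)

lemma wasserstein_less_coupling:
  fixes \<mu> \<nu> :: "'a::euclidean_space measure"
  assumes p: "1 \<le> p" and m: "\<mu> \<in> prob_moment p" "\<nu> \<in> prob_moment p" and w: "wasserstein p \<mu> \<nu> < w"
  obtains \<gamma> where "\<gamma> \<in> couplings \<mu> \<nu>" "(\<integral>z. norm (snd z - fst z) powr p \<partial>\<gamma>) < w powr p"
proof -
  have ne: "couplings \<mu> \<nu> \<noteq> {}"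
    using pair_measure_coupling[of \<mu> \<nu>] prob_momentD[OF m(1)] prob_momentD[OF m(2)] by auto
  obtain \<gamma> where g: "\<gamma> \<in> couplings \<mu> \<nu>" and l: "(\<integral>z. norm (snd z - fst z) powr p \<partial>\<gamma>) powr (1 / p) < w"
    using w unfolding wasserstein_def cINF_less_iff[OF ne wasserstein_bdd_below] by blast
  let ?I = "\<integral>z. norm (snd z - fst z) powr p \<partial>\<gamma>"
  have "(?I powr (1 / p)) powr p < w powr p"
    using l p by (intro powr_less_mono2) auto
  moreover have "0 \<le> ?I" by simp
  ultimately have "?I < w powr p" using p by (simp add: powr_powr)
  with g that show ?thesis by blast
qed

text \<open>Transport along a map. The identity gives distance 0 from a law to itself, and
  translations give the competitors of the lower bound.\<close>

lemma distr_coupling: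
  fixes \<mu> :: "'a::euclidean_space measure"
  assumes "prob_space \<mu>" and s: "sets \<mu> = sets borel" and T[measurable]: "T \<in> borel_measurable borel"
  shows "distr \<mu> (borel \<Otimes>\<^sub>M borel) (\<lambda>y. (y, T y)) \<in> couplings \<mu> (distr \<mu> borel T)"
proof -
  note [measurable_cong] = s
  interpret prob_space \<mu> by fact
  have "distr \<mu> borel (\<lambda>y. y) = \<mu>" by (rule distr_id2) (use s in simp)
  moreover have "prob_space (distr \<mu> (borel \<Otimes>\<^sub>M borel) (\<lambda>y. (y, T y)))"
    by (rule prob_space_distr) measurable
  ultimately show ?thesis
    unfolding couplings_def by (auto simp: distr_distr comp_def)
qed

lemma integral_distr_coupling:
  fixes \<mu> :: "'a::euclidean_space measure"
  assumes s: "sets \<mu> = sets borel" and T[measurable]: "T \<in> borel_measurable borel"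
  shows "(\<integral>z. norm (snd z - fst z) powr p \<partial>distr \<mu> (borel \<Otimes>\<^sub>M borel) (\<lambda>y. (y, T y)))
    = (\<integral>y. norm (T y - y) powr p \<partial>\<mu>)"
proof -
  note [measurable_cong] = s
  show ?thesis by (subst integral_distr) auto
qed

lemma wasserstein_refl:
  fixes \<mu> :: "'a::euclidean_space measure"
  assumes p: "1 \<le> p" and m: "\<mu> \<in> prob_moment p"
  shows "wasserstein p \<mu> \<mu> = 0"
proof -
  note d = prob_momentD[OF m]
  have id: "distr \<mu> borel (\<lambda>x. x) = \<mu>" by (rule distr_id2) (use d in simp)
  have "wasserstein p \<mu> \<mu> \<le> 0"
    using distr_coupling[OF d(1,2), of "\<lambda>x. x"] integral_distr_coupling[OF d(2), of "\<lambda>x. x" p] p id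
    by (intro wasserstein_le[OF p]) auto
  with wasserstein_nonneg[OF m m] show ?thesis by simp
qed

section \<open>Composition of couplings along increments\<close>

text \<open>Both marginals of a coupling are convolved at once: the second increment is drawn from
  a kernel that may depend on the second coordinate of the first increment.\<close>

definition glue :: "('a::euclidean_space \<times> 'a) measure \<Rightarrow> ('a \<Rightarrow> ('a \<times> 'a) measure) \<Rightarrow> ('a \<times> 'a) measure" where
  "glue \<gamma> K = \<gamma> \<bind> (\<lambda>w. distr (K (snd w)) (borel \<Otimes>\<^sub>M borel) (\<lambda>z. (fst w + fst z, snd w + snd z)))"

context
  fixes \<gamma> :: "('a::euclidean_space \<times> 'a) measure" and \<mu> \<mu>' \<nu> :: "'a measure" and \<nu>' and K :: "'a \<Rightarrow> ('a \<times> 'a) measure"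
  assumes g: "\<gamma> \<in> couplings \<mu> \<nu>"
    and K[measurable]: "K \<in> borel \<rightarrow>\<^sub>M subprob_algebra (borel \<Otimes>\<^sub>M borel)"
    and K_coupling: "\<And>y. K y \<in> couplings \<mu>' (\<nu>' y)"
begin

private lemma glue_sets[measurable_cong]: "sets \<gamma> = sets (borel \<Otimes>\<^sub>M borel)" and glue_ne: "space \<gamma> \<noteq> {}"
  using couplingsD[OF g] by (auto simp: prob_space.not_empty)

private lemma K_sets: "sets (K y) = sets (borel \<Otimes>\<^sub>M borel)"
  using couplingsD[OF K_coupling] by auto

private lemma K_meas: "measurable (K y) N = measurable (borel \<Otimes>\<^sub>M borel) N"
  using K_sets by (rule measurable_cong_sets) simp

private lemma glue_kernel[measurable]:
  "(\<lambda>w :: 'a \<times> 'a. distr (K (snd w)) (borel \<Otimes>\<^sub>M borel) (\<lambda>z. (fst w + fst z, snd w + snd z)))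
    \<in> \<gamma> \<rightarrow>\<^sub>M subprob_algebra (borel \<Otimes>\<^sub>M borel)"
  by (rule measurable_distr2[where M = "borel \<Otimes>\<^sub>M borel"]) measurable

lemma glue_prob: "prob_space (glue \<gamma> K)"
  unfolding glue_def
proof (rule prob_space.prob_space_bind)
  show "prob_space \<gamma>" using couplingsD[OF g] by simp
  show "AE w in \<gamma>. prob_space (distr (K (snd w)) (borel \<Otimes>\<^sub>M borel) (\<lambda>z. (fst w + fst z, snd w + snd z)))"
  proof (rule AE_I2)
    fix w :: "'a \<times> 'a"
    show "prob_space (distr (K (snd w)) (borel \<Otimes>\<^sub>M borel) (\<lambda>z. (fst w + fst z, snd w + snd z)))"
      using couplingsD(1)[OF K_coupling] by (rule prob_space.prob_space_distr) (simp add: K_meas)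
  qed
qed measurable

lemma glue_sets_eq: "sets (glue \<gamma> K) = sets (borel \<Otimes>\<^sub>M borel)"
  unfolding glue_def by (rule sets_bind) (auto simp: glue_ne)

lemma nn_integral_glue:
  assumes [measurable]: "h \<in> borel_measurable (borel \<Otimes>\<^sub>M borel)"
  shows "(\<integral>\<^sup>+z. h z \<partial>glue \<gamma> K) = (\<integral>\<^sup>+w. \<integral>\<^sup>+z. h (fst w + fst z, snd w + snd z) \<partial>K (snd w) \<partial>\<gamma>)"
  unfolding glue_def
  by (subst nn_integral_bind[where B = "borel \<Otimes>\<^sub>M borel"]) (auto simp: nn_integral_distr K_meas)

lemma integral_glue:
  fixes h :: "'a \<times> 'a \<Rightarrow> real"
  assumes [measurable]: "h \<in> borel_measurable (borel \<Otimes>\<^sub>M borel)" and B: "\<And>z. \<bar>h z\<bar> \<le> B"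
  shows "(\<integral>z. h z \<partial>glue \<gamma> K) = (\<integral>w. \<integral>z. h (fst w + fst z, snd w + snd z) \<partial>K (snd w) \<partial>\<gamma>)"
proof -
  interpret G: prob_space \<gamma> using couplingsD[OF g] by simp
  have "(\<integral>z. h z \<partial>glue \<gamma> K) = (\<integral>w. \<integral>z. h z \<partial>distr (K (snd w)) (borel \<Otimes>\<^sub>M borel) (\<lambda>z. (fst w + fst z, snd w + snd z)) \<partial>\<gamma>)"
    unfolding glue_def
  proof (rule integral_bind[where K = "borel \<Otimes>\<^sub>M borel" and B = B and B' = 1], goal_cases)
    case 5
    show ?case
    proof (rule AE_I2)
      fix w :: "'a \<times> 'a"
      interpret k: prob_space "distr (K (snd w)) (borel \<Otimes>\<^sub>M borel) (\<lambda>z. (fst w + fst z, snd w + snd z))"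
        using couplingsD(1)[OF K_coupling] by (rule prob_space.prob_space_distr) (simp add: K_meas)
      show "emeasure (distr (K (snd w)) (borel \<Otimes>\<^sub>M borel) (\<lambda>z. (fst w + fst z, snd w + snd z)))
          (space (distr (K (snd w)) (borel \<Otimes>\<^sub>M borel) (\<lambda>z. (fst w + fst z, snd w + snd z)))) \<le> ennreal 1"
        using k.emeasure_space_1 by simp
    qed
  qed (use B in \<open>auto intro: G.finite_measure_axioms\<close>)
  also have "\<dots> = (\<integral>w. \<integral>z. h (fst w + fst z, snd w + snd z) \<partial>K (snd w) \<partial>\<gamma>)"
    by (intro Bochner_Integration.integral_cong refl integral_distr) (auto simp: K_meas)
  finally show ?thesis .
qed

text \<open>Every \<open>K y\<close> has the same first marginal \<open>\<mu>'\<close>, so the first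
  coordinate of the second increment is independent of the first increment, although the kernel
  looks at \<open>snd w\<close>. The first coordinates therefore add up to a convolution.\<close>

lemma glue_fst: "distr (glue \<gamma> K) borel fst = distr (\<mu> \<Otimes>\<^sub>M \<mu>') borel (\<lambda>z. fst z + snd z)"
proof (rule measure_eqI)
  note c = couplingsD[OF g] and c' = couplingsD[OF K_coupling]
  have sm: "sets \<mu> = sets borel" "sets \<mu>' = sets borel"
    unfolding c(3)[symmetric] c'(3)[symmetric, of undefined] by simp_all
  note [measurable_cong] = sm glue_sets_eq
  interpret K': prob_space \<mu>'
    unfolding c'(3)[symmetric, of undefined] using c'(1) by (rule prob_space.prob_space_distr) (simp add: K_meas)
  fix A assume "A \<in> sets (distr (glue \<gamma> K) borel fst)"
  then have [measurable]: "A \<in> sets borel" by simp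
  have m: "(\<lambda>x. \<integral>\<^sup>+y. indicator A (x + y) \<partial>\<mu>') \<in> borel_measurable borel" by measurable
  have "emeasure (distr (glue \<gamma> K) borel fst) A = (\<integral>\<^sup>+z. indicator A (fst z) \<partial>glue \<gamma> K)"
    by (subst nn_integral_indicator[symmetric], simp, subst nn_integral_distr) auto
  also have "\<dots> = (\<integral>\<^sup>+w. \<integral>\<^sup>+z. indicator A (fst w + fst z) \<partial>K (snd w) \<partial>\<gamma>)"
    by (subst nn_integral_glue) auto
  also have "\<dots> = (\<integral>\<^sup>+w. \<integral>\<^sup>+y. indicator A (fst w + y) \<partial>\<mu>' \<partial>\<gamma>)"
  proof (intro nn_integral_cong)
    fix w :: "'a \<times> 'a"
    show "(\<integral>\<^sup>+z. indicator A (fst w + fst z) \<partial>K (snd w)) = (\<integral>\<^sup>+y. indicator A (fst w + y) \<partial>\<mu>')"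
      unfolding c'(3)[symmetric, of "snd w"] by (subst nn_integral_distr) (auto simp: K_meas)
  qed
  also have "\<dots> = (\<integral>\<^sup>+x. \<integral>\<^sup>+y. indicator A (x + y) \<partial>\<mu>' \<partial>\<mu>)"
    unfolding c(3)[symmetric] using m by (subst nn_integral_distr) auto
  also have "\<dots> = (\<integral>\<^sup>+z. indicator A (fst z + snd z) \<partial>(\<mu> \<Otimes>\<^sub>M \<mu>'))"
    by (subst K'.nn_integral_fst[symmetric]) auto
  also have "\<dots> = emeasure (distr (\<mu> \<Otimes>\<^sub>M \<mu>') borel (\<lambda>z. fst z + snd z)) A"
    by (subst nn_integral_indicator[symmetric], simp, subst nn_integral_distr) auto
  finally show "emeasure (distr (glue \<gamma> K) borel fst) A = emeasure (distr (\<mu> \<Otimes>\<^sub>M \<mu>') borel (\<lambda>z. fst z + snd z)) A" .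
qed simp

lemma glue_coupling:
  "glue \<gamma> K \<in> couplings (distr (\<mu> \<Otimes>\<^sub>M \<mu>') borel (\<lambda>z. fst z + snd z)) (distr (glue \<gamma> K) borel snd)"
  unfolding couplings_def using glue_prob glue_sets_eq glue_fst by auto

lemma integral_glue_snd:
  fixes h :: "'a \<Rightarrow> real"
  assumes [measurable]: "h \<in> borel_measurable borel" and B: "\<And>z. \<bar>h z\<bar> \<le> B"
  shows "(\<integral>z. h z \<partial>distr (glue \<gamma> K) borel snd) = (\<integral>y. \<integral>z. h (y + z) \<partial>\<nu>' y \<partial>\<nu>)"
    and "(\<lambda>y. \<integral>z. h (y + z) \<partial>\<nu>' y) \<in> borel_measurable borel"
proof -
  note c = couplingsD[OF g] and c' = couplingsD[OF K_coupling]
  note [measurable_cong] = glue_sets_eq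
  have eq: "(\<integral>z. h (y + snd z) \<partial>K y) = (\<integral>z. h (y + z) \<partial>\<nu>' y)" for y
    unfolding c'(4)[symmetric, of y] by (subst integral_distr) (auto simp: K_meas)
  \<comment> \<open>Integrand and measure both depend on \<open>y\<close>. Pushing
    \<open>K y\<close> forward to the real line moves this dependence into the kernel and leaves the
    identity as integrand.\<close>
  have "(\<lambda>y. distr (K y) borel (\<lambda>z. h (y + snd z))) \<in> borel \<rightarrow>\<^sub>M subprob_algebra borel"
    by (rule measurable_distr2[where M = "borel \<Otimes>\<^sub>M borel"]) measurable
  from measurable_compose[OF this integral_measurable_subprob_algebra[of "\<lambda>z. z" borel]]
  have "(\<lambda>y. \<integral>z. z \<partial>(distr (K y) borel (\<lambda>z. h (y + snd z)))) \<in> borel_measurable borel"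
    by simp
  moreover have "(\<integral>z. z \<partial>(distr (K y) borel (\<lambda>z. h (y + snd z)))) = (\<integral>z. h (y + z) \<partial>\<nu>' y)" for y
    unfolding eq[symmetric] by (rule integral_distr) (auto simp: K_meas)
  ultimately show m: "(\<lambda>y. \<integral>z. h (y + z) \<partial>\<nu>' y) \<in> borel_measurable borel" by simp
  have "(\<integral>z. h z \<partial>distr (glue \<gamma> K) borel snd) = (\<integral>z. h (snd z) \<partial>glue \<gamma> K)"
    by (subst integral_distr) auto
  also have "\<dots> = (\<integral>w. \<integral>z. h (snd w + z) \<partial>\<nu>' (snd w) \<partial>\<gamma>)"
    by (subst integral_glue[of _ B]) (use B eq in auto)
  also have "\<dots> = (\<integral>y. \<integral>z. h (y + z) \<partial>\<nu>' y \<partial>\<nu>)"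
    unfolding c(4)[symmetric] by (rule integral_distr[symmetric]) (use m in auto)
  finally show "(\<integral>z. h z \<partial>distr (glue \<gamma> K) borel snd) = (\<integral>y. \<integral>z. h (y + z) \<partial>\<nu>' y \<partial>\<nu>)" .
qed


text \<open>The right-hand side sees \<open>\<gamma>\<close> and \<open>K\<close> only through their
  second marginals. Hence different couplings with these second marginals are glued to couplings
  with one and the same second marginal.\<close>

lemma emeasure_glue_snd:
  assumes [measurable]: "A \<in> sets borel"
  shows "emeasure (distr (glue \<gamma> K) borel snd) A = (\<integral>\<^sup>+y. \<integral>\<^sup>+z. indicator A (y + z) \<partial>\<nu>' y \<partial>\<nu>)"
proof -
  note c = couplingsD[OF g] and c' = couplingsD[OF K_coupling]
  note [measurable_cong] = glue_sets_eq
  have m: "(\<lambda>y. \<integral>\<^sup>+z. indicator A (y + snd z) \<partial>K y) \<in> borel_measurable borel"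
    by (rule nn_integral_measurable_subprob_algebra2[where N = "borel \<Otimes>\<^sub>M borel"]) measurable
  have "emeasure (distr (glue \<gamma> K) borel snd) A = (\<integral>\<^sup>+z. indicator A (snd z) \<partial>glue \<gamma> K)"
    by (subst nn_integral_indicator[symmetric], simp, subst nn_integral_distr) auto
  also have "\<dots> = (\<integral>\<^sup>+w. \<integral>\<^sup>+z. indicator A (snd w + snd z) \<partial>K (snd w) \<partial>\<gamma>)"
    by (subst nn_integral_glue) auto
  also have "\<dots> = (\<integral>\<^sup>+y. \<integral>\<^sup>+z. indicator A (y + snd z) \<partial>K y \<partial>\<nu>)"
    unfolding c(4)[symmetric] using m by (subst nn_integral_distr) auto
  also have "\<dots> = (\<integral>\<^sup>+y. \<integral>\<^sup>+z. indicator A (y + z) \<partial>\<nu>' y \<partial>\<nu>)"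
  proof (intro nn_integral_cong)
    fix y :: 'a
    show "(\<integral>\<^sup>+z. indicator A (y + snd z) \<partial>K y) = (\<integral>\<^sup>+z. indicator A (y + z) \<partial>\<nu>' y)"
      unfolding c'(4)[symmetric, of y] by (subst nn_integral_distr) (auto simp: K_meas)
  qed
  finally show ?thesis .
qed

text \<open>Minkowski's inequality for the two displacements. The cost of the kernel enters averaged
  over \<open>\<nu>\<close>, because \<open>K\<close> is evaluated at \<open>snd w\<close>, which
  has law \<open>\<nu>\<close>.\<close>

lemma glue_cost:
  assumes p: "1 \<le> p" and AB: "0 < A" "0 < B"
    and cA: "(\<integral>\<^sup>+z. ennreal (norm (snd z - fst z) powr p) \<partial>\<gamma>) \<le> ennreal (A powr p)"
    and cB: "(\<integral>\<^sup>+y. \<integral>\<^sup>+z. ennreal (norm (snd z - fst z) powr p) \<partial>K y \<partial>\<nu>) \<le> ennreal (B powr p)"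
  shows "(\<integral>\<^sup>+z. ennreal (norm (snd z - fst z) powr p) \<partial>glue \<gamma> K) \<le> ennreal ((A + B) powr p)"
proof -
  note c = couplingsD[OF g] and c' = couplingsD[OF K_coupling]
  interpret G: prob_space \<gamma> by (fact c)
  \<comment> \<open>The weights of \<open>powr_convex_combination\<close>; they satisfy
    \<open>?a * A powr p + ?b * B powr p = (A + B) powr p\<close>.\<close>
  let ?a = "(A + B) powr p * (A / (A + B)) / A powr p" and ?b = "(A + B) powr p * (B / (A + B)) / B powr p"
  let ?n = "\<lambda>z :: 'a \<times> 'a. ennreal (norm (snd z - fst z) powr p)"
  have mK: "(\<lambda>y. \<integral>\<^sup>+z. ?n z \<partial>K y) \<in> borel_measurable borel"
    by (rule nn_integral_measurable_subprob_algebra2[where N = "borel \<Otimes>\<^sub>M borel"]) auto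
  have lin: "ennreal (a * x + b * y) = ennreal a * ennreal x + ennreal b * ennreal y"
    if "0 \<le> a" "0 \<le> x" "0 \<le> b" "0 \<le> y" for a b x y :: real
    using that by (simp add: ennreal_mult)
  have pw: "ennreal (norm (snd w + snd z - (fst w + fst z)) powr p) \<le> ennreal ?a * ?n w + ennreal ?b * ?n z" for w z :: "'a \<times> 'a"
  proof -
    have "norm (snd w + snd z - (fst w + fst z)) powr p \<le> (norm (snd w - fst w) + norm (snd z - fst z)) powr p"
      using p norm_triangle_ineq[of "snd w - fst w" "snd z - fst z"] by (intro powr_mono2) (auto simp: algebra_simps)
    also have "\<dots> \<le> ?a * norm (snd w - fst w) powr p + ?b * norm (snd z - fst z) powr p"
      using powr_convex_combination[OF p norm_ge_zero[of "snd w - fst w"] norm_ge_zero[of "snd z - fst z"] AB]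
      by (simp add: algebra_simps)
    finally have "ennreal (norm (snd w + snd z - (fst w + fst z)) powr p)
        \<le> ennreal (?a * norm (snd w - fst w) powr p + ?b * norm (snd z - fst z) powr p)"
      by (rule ennreal_leI)
    also have "\<dots> = ennreal ?a * ?n w + ennreal ?b * ?n z"
      using AB by (intro lin) auto
    finally show ?thesis .
  qed
  have "(\<integral>\<^sup>+z. ?n z \<partial>glue \<gamma> K) = (\<integral>\<^sup>+w. \<integral>\<^sup>+z. ennreal (norm (snd w + snd z - (fst w + fst z)) powr p) \<partial>K (snd w) \<partial>\<gamma>)"
    by (subst nn_integral_glue) auto
  also have "\<dots> \<le> (\<integral>\<^sup>+w. \<integral>\<^sup>+z. ennreal ?a * ?n w + ennreal ?b * ?n z \<partial>K (snd w) \<partial>\<gamma>)"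
    by (intro nn_integral_mono pw)
  also have "\<dots> = (\<integral>\<^sup>+w. ennreal ?a * ?n w + ennreal ?b * (\<integral>\<^sup>+z. ?n z \<partial>K (snd w)) \<partial>\<gamma>)"
  proof (intro nn_integral_cong)
    fix w :: "'a \<times> 'a"
    interpret k: prob_space "K (snd w)" by (rule c')
    show "(\<integral>\<^sup>+z. ennreal ?a * ?n w + ennreal ?b * ?n z \<partial>K (snd w)) = ennreal ?a * ?n w + ennreal ?b * (\<integral>\<^sup>+z. ?n z \<partial>K (snd w))"
      by (subst nn_integral_add) (auto simp: K_meas nn_integral_cmult k.emeasure_space_1)
  qed
  also have "\<dots> = ennreal ?a * (\<integral>\<^sup>+w. ?n w \<partial>\<gamma>) + ennreal ?b * (\<integral>\<^sup>+w. \<integral>\<^sup>+z. ?n z \<partial>K (snd w) \<partial>\<gamma>)"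
    using mK by (subst nn_integral_add) (auto simp: nn_integral_cmult)
  also have "(\<integral>\<^sup>+w. \<integral>\<^sup>+z. ?n z \<partial>K (snd w) \<partial>\<gamma>) = (\<integral>\<^sup>+y. \<integral>\<^sup>+z. ?n z \<partial>K y \<partial>\<nu>)"
    unfolding c(4)[symmetric] using mK by (subst nn_integral_distr) auto
  also have "ennreal ?a * (\<integral>\<^sup>+w. ?n w \<partial>\<gamma>) + ennreal ?b * (\<integral>\<^sup>+y. \<integral>\<^sup>+z. ?n z \<partial>K y \<partial>\<nu>)
      \<le> ennreal ?a * ennreal (A powr p) + ennreal ?b * ennreal (B powr p)"
    by (intro add_mono mult_left_mono cA cB) auto
  also have "\<dots> = ennreal (?a * A powr p + ?b * B powr p)"
    using AB by (intro lin[symmetric]) auto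
  also have "?a * A powr p + ?b * B powr p = (A + B) powr p * ((A + B) / (A + B))"
  proof -
    have "?a * A powr p = (A + B) powr p * (A / (A + B))" "?b * B powr p = (A + B) powr p * (B / (A + B))"
      using AB by simp_all
    then show ?thesis by (simp only: add_divide_distrib distrib_left)
  qed
  also have "\<dots> = (A + B) powr p" using AB by simp
  finally show ?thesis .
qed

end

text \<open>A finite cost carries a finite moment from the source to the target. This is how a
  constructed law is recognised as an admissible competitor in \<open>pert\<close>.\<close>

lemma coupling_snd_moment:
  fixes \<mu> \<nu> :: "'a::euclidean_space measure"
  assumes p: "1 \<le> p" and m: "\<mu> \<in> prob_moment p" and g: "\<gamma> \<in> couplings \<mu> \<nu>"
    and cost: "integrable \<gamma> (\<lambda>z. norm (snd z - fst z) powr p)"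
  shows "\<nu> \<in> prob_moment p"
proof -
  note c = couplingsD[OF g]
  note [measurable_cong] = c(2)
  have snd_meas[measurable]: "snd \<in> \<gamma> \<rightarrow>\<^sub>M borel"
    by (subst measurable_cong_sets[OF c(2) refl]) (rule measurable_snd)
  have int: "integrable \<gamma> (\<lambda>z. norm (fst z) powr p)"
    using integral_coupling_fst(2)[OF g, of "\<lambda>x. norm x powr p"] prob_momentD(3)[OF m] by auto
  have "integrable \<gamma> (\<lambda>z. norm (snd z) powr p)"
  proof (rule Bochner_Integration.integrable_bound)
    show "integrable \<gamma> (\<lambda>z. 2 powr p * (1/2 * norm (fst z) powr p + 1/2 * norm (snd z - fst z) powr p))"
      using int cost by auto
    show "(\<lambda>z. norm (snd z) powr p) \<in> borel_measurable \<gamma>"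
      by (rule measurable_compose[OF snd_meas]) measurable
    show "AE z in \<gamma>. norm (norm (snd z) powr p)
        \<le> norm (2 powr p * (1/2 * norm (fst z) powr p + 1/2 * norm (snd z - fst z) powr p))"
    proof (rule AE_I2)
      fix z
      have "norm (snd z) powr p \<le> (norm (fst z) + norm (snd z - fst z)) powr p"
        using p norm_triangle_ineq[of "fst z" "snd z - fst z"] by (intro powr_mono2) auto
      also have "\<dots> \<le> 2 powr p * (1/2 * norm (fst z) powr p + 1/2 * norm (snd z - fst z) powr p)"
        using powr_convex_combination[of p "norm (fst z)" "norm (snd z - fst z)" 1 1] p by simp
      finally show "norm (norm (snd z) powr p)
        \<le> norm (2 powr p * (1/2 * norm (fst z) powr p + 1/2 * norm (snd z - fst z) powr p))" by simp
    qed
  qed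
  then have "integrable \<nu> (\<lambda>x. norm x powr p)"
    using integral_coupling_snd(2)[OF g, of "\<lambda>x. norm x powr p"] by simp
  moreover have "prob_space \<nu>" "sets \<nu> = sets borel"
    using prob_space.prob_space_distr[OF c(1) snd_meas] c(4) by auto
  ultimately show ?thesis unfolding prob_moment_def by simp
qed

section \<open>Second increments drawn from finitely many laws\<close>

lemma integral_finite_index:
  fixes \<kappa> :: "nat \<Rightarrow> real"
  assumes "prob_space \<nu>" and J[measurable]: "J \<in> \<nu> \<rightarrow>\<^sub>M count_space UNIV" and N: "\<And>y. J y \<le> N"
  shows "integrable \<nu> (\<lambda>y. \<kappa> (J y))"
    and "(\<integral>y. \<kappa> (J y) \<partial>\<nu>) = (\<Sum>i\<le>N. measure \<nu> {y \<in> space \<nu>. J y = i} * \<kappa> i)"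
proof -
  interpret prob_space \<nu> by fact
  have eq: "\<kappa> (J y) = (\<Sum>i\<le>N. indicator {y \<in> space \<nu>. J y = i} y * \<kappa> i)" if "y \<in> space \<nu>" for y
    using that N[of y] by (subst sum.remove[of _ "J y"]) (auto intro!: sum.neutral)
  have i: "integrable \<nu> (\<lambda>y. indicator {y \<in> space \<nu>. J y = i} y * \<kappa> i)" for i
    by (rule integrable_const_bound[of _ "\<bar>\<kappa> i\<bar>"]) (auto simp: indicator_def)
  show "integrable \<nu> (\<lambda>y. \<kappa> (J y))"
    by (subst Bochner_Integration.integrable_cong[OF refl eq], assumption) (intro Bochner_Integration.integrable_sum i)
  have "(\<integral>y. \<kappa> (J y) \<partial>\<nu>) = (\<integral>y. (\<Sum>i\<le>N. indicator {y \<in> space \<nu>. J y = i} y * \<kappa> i) \<partial>\<nu>)"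
    by (rule Bochner_Integration.integral_cong[OF refl eq])
  also have "\<dots> = (\<Sum>i\<le>N. \<integral>y. indicator {y \<in> space \<nu>. J y = i} y * \<kappa> i \<partial>\<nu>)"
    by (rule Bochner_Integration.integral_sum[OF i])
  finally show "(\<integral>y. \<kappa> (J y) \<partial>\<nu>) = (\<Sum>i\<le>N. measure \<nu> {y \<in> space \<nu>. J y = i} * \<kappa> i)" by simp
qed

text \<open>The kernel takes finitely many values, selected by \<open>J\<close>, so its
  measurability is that of \<open>J\<close>. The strict inequalities for \<open>A\<close> and
  \<open>B\<close> leave room for near-optimal couplings.\<close>

lemma coupling_add_kernel:
  fixes \<mu> \<mu>' \<nu> :: "'a::euclidean_space measure" and \<nu>' :: "nat \<Rightarrow> 'a measure"
  assumes p: "1 < p"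
    and m: "\<mu> \<in> prob_moment p" "\<nu> \<in> prob_moment p" "\<mu>' \<in> prob_moment p" "\<And>i. \<nu>' i \<in> prob_moment p"
    and J[measurable]: "J \<in> borel \<rightarrow>\<^sub>M count_space UNIV" and N: "\<And>y. J y \<le> N"
    and A: "wasserstein p \<mu> \<nu> < A"
    and B: "(\<Sum>i\<le>N. measure \<nu> {y. J y = i} * wasserstein p \<mu>' (\<nu>' i) powr p) < B powr p" "0 < B"
  obtains \<gamma> K where "\<gamma> \<in> couplings \<mu> \<nu>" "K \<in> borel \<rightarrow>\<^sub>M subprob_algebra (borel \<Otimes>\<^sub>M borel)"
    "\<forall>y. K y \<in> couplings \<mu>' (\<nu>' (J y))"
    "(\<integral>\<^sup>+z. ennreal (norm (snd z - fst z) powr p) \<partial>glue \<gamma> K) \<le> ennreal ((A + B) powr p)"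
proof -
  note d = prob_momentD[OF m(2)]
  let ?cost = "\<lambda>\<gamma>. \<integral>z. norm (snd z - fst z) powr p \<partial>\<gamma>"
  let ?W = "\<lambda>i. wasserstein p \<mu>' (\<nu>' i)"
  interpret N: prob_space \<nu> by (fact d)
  note [measurable_cong] = d(2)
  have p1: "1 \<le> p" using p by simp
  have sp: "space \<nu> = UNIV" using sets_eq_imp_space_eq[OF d(2)] by simp
  have W0: "0 \<le> ?W i" for i using m by (intro wasserstein_nonneg)
  \<comment> \<open>The whole slack in the hypothesis on \<open>B\<close>. As the pieces of
    \<open>J\<close> have total mass 1, every conditional coupling may exceed its optimal cost by
    \<open>\<eta>\<close>.\<close>
  define \<eta> where "\<eta> = B powr p - (\<Sum>i\<le>N. measure \<nu> {y. J y = i} * ?W i powr p)"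
  have \<eta>: "0 < \<eta>" using B unfolding \<eta>_def by simp
  obtain \<gamma> where g: "\<gamma> \<in> couplings \<mu> \<nu>" and gc: "?cost \<gamma> < A powr p"
    using wasserstein_less_coupling[OF p1 m(1,2) A] by blast
  have "\<exists>\<gamma>\<in>couplings \<mu>' (\<nu>' i). ?cost \<gamma> \<le> ?W i powr p + \<eta>" for i
  proof -
    have "(?W i powr p) powr (1 / p) < (?W i powr p + \<eta>) powr (1 / p)"
      using \<eta> p by (intro powr_less_mono2) auto
    then have "?W i < (?W i powr p + \<eta>) powr (1 / p)"
      using p W0[of i] by (simp add: powr_powr)
    from wasserstein_less_coupling[OF p1 m(3,4) this] show ?thesis
      using \<eta> p by (auto simp: powr_powr intro!: less_imp_le)
  qed
  then obtain \<gamma>' where g': "\<And>i. \<gamma>' i \<in> couplings \<mu>' (\<nu>' i)" "\<And>i. ?cost (\<gamma>' i) \<le> ?W i powr p + \<eta>"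
    by metis
  have K: "(\<lambda>y. \<gamma>' (J y)) \<in> borel \<rightarrow>\<^sub>M subprob_algebra (borel \<Otimes>\<^sub>M borel)"
    by (rule measurable_compose[OF J])
       (use couplingsD[OF g'(1)] in \<open>auto simp: space_subprob_algebra intro: prob_space_imp_subprob_space\<close>)
  have int: "integrable \<gamma> (\<lambda>z. norm (snd z - fst z) powr p)"
    "integrable (\<gamma>' i) (\<lambda>z. norm (snd z - fst z) powr p)" for i
    using coupling_cost_integrable[OF p1 m(1,2) g] coupling_cost_integrable[OF p1 m(3,4) g'(1)] by auto
  have ci: "integrable \<nu> (\<lambda>y. ?cost (\<gamma>' (J y)))"
    by (rule integral_finite_index(1)[OF N.prob_space_axioms _ N]) measurable
  have "(\<integral>\<^sup>+y. \<integral>\<^sup>+z. ennreal (norm (snd z - fst z) powr p) \<partial>\<gamma>' (J y) \<partial>\<nu>) = (\<integral>\<^sup>+y. ennreal (?cost (\<gamma>' (J y))) \<partial>\<nu>)"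
    using int by (intro nn_integral_cong nn_integral_eq_integral) auto
  also have "\<dots> = ennreal (\<integral>y. ?cost (\<gamma>' (J y)) \<partial>\<nu>)"
    using ci by (intro nn_integral_eq_integral) auto
  also have "(\<integral>y. ?cost (\<gamma>' (J y)) \<partial>\<nu>) \<le> (\<integral>y. ?W (J y) powr p + \<eta> \<partial>\<nu>)"
    using ci g' integral_finite_index(1)[OF N.prob_space_axioms _ N, where \<kappa> = "\<lambda>i. ?W i powr p"]
    by (intro integral_mono) auto
  also have "\<dots> = (\<integral>y. ?W (J y) powr p \<partial>\<nu>) + \<eta>"
    using integral_finite_index(1)[OF N.prob_space_axioms _ N, where \<kappa> = "\<lambda>i. ?W i powr p"]
    by (simp add: N.prob_space)
  also have "\<dots> = B powr p"
    using integral_finite_index(2)[OF N.prob_space_axioms _ N, where \<kappa> = "\<lambda>i. ?W i powr p"]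
    by (simp add: \<eta>_def sp)
  finally have cB: "(\<integral>\<^sup>+y. \<integral>\<^sup>+z. ennreal (norm (snd z - fst z) powr p) \<partial>\<gamma>' (J y) \<partial>\<nu>) \<le> ennreal (B powr p)"
    by (simp add: ennreal_leI)
  have cA: "(\<integral>\<^sup>+z. ennreal (norm (snd z - fst z) powr p) \<partial>\<gamma>) \<le> ennreal (A powr p)"
    using gc int(1) by (subst nn_integral_eq_integral) (auto intro!: ennreal_leI)
  have "0 < A" using A wasserstein_nonneg[OF m(1,2)] by simp
  from glue_cost[OF g K g'(1) p1 this B(2) cA cB] show ?thesis
    using g K g'(1) by (intro that) auto
qed

text \<open>\<open>\<pi>\<close> is the law of a sum whose second increment has law
  \<open>\<nu>' (J y)\<close> after a first increment \<open>y\<close>. Minkowski's inequality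
  bounds its distance from the convolution by the first distance plus the \<open>p\<close>-mean of
  the conditional ones.\<close>

lemma wasserstein_add_kernel:
  fixes \<mu> \<mu>' \<nu> :: "'a::euclidean_space measure" and \<nu>' :: "nat \<Rightarrow> 'a measure"
  assumes p: "1 < p"
    and m: "\<mu> \<in> prob_moment p" "\<nu> \<in> prob_moment p" "\<mu>' \<in> prob_moment p" "\<And>i. \<nu>' i \<in> prob_moment p"
    and m_add: "distr (\<mu> \<Otimes>\<^sub>M \<mu>') borel (\<lambda>z. fst z + snd z) \<in> prob_moment p"
    and J: "J \<in> borel \<rightarrow>\<^sub>M count_space UNIV" and N: "\<And>y. J y \<le> N"
  obtains \<pi> where "\<pi> \<in> prob_moment p"
    "wasserstein p (distr (\<mu> \<Otimes>\<^sub>M \<mu>') borel (\<lambda>z. fst z + snd z)) \<pi>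
      \<le> wasserstein p \<mu> \<nu> + (\<Sum>i\<le>N. measure \<nu> {y. J y = i} * wasserstein p \<mu>' (\<nu>' i) powr p) powr (1 / p)"
    "\<forall>h B. h \<in> borel_measurable borel \<longrightarrow> (\<forall>z. \<bar>h z\<bar> \<le> (B::real)) \<longrightarrow>
      (\<integral>z. h z \<partial>\<pi>) = (\<integral>y. \<integral>z. h (y + z) \<partial>\<nu>' (J y) \<partial>\<nu>) \<and>
      (\<lambda>y. \<integral>z. h (y + z) \<partial>\<nu>' (J y)) \<in> borel_measurable borel"
proof -
  have p1: "1 \<le> p" using p by simp
  let ?a = "wasserstein p \<mu> \<nu>"
  let ?s = "\<Sum>i\<le>N. measure \<nu> {y. J y = i} * wasserstein p \<mu>' (\<nu>' i) powr p"
  let ?b = "?s powr (1 / p)"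
  let ?\<mu> = "distr (\<mu> \<Otimes>\<^sub>M \<mu>') borel (\<lambda>z. fst z + snd z)"
  let ?good = "\<lambda>e \<gamma> K. \<gamma> \<in> couplings \<mu> \<nu> \<and> K \<in> borel \<rightarrow>\<^sub>M subprob_algebra (borel \<Otimes>\<^sub>M borel)
    \<and> (\<forall>y. K y \<in> couplings \<mu>' (\<nu>' (J y)))
    \<and> (\<integral>\<^sup>+z. ennreal (norm (snd z - fst z) powr p) \<partial>glue \<gamma> K) \<le> ennreal ((?a + ?b + e) powr p)"
  have s0: "0 \<le> ?s" by (intro sum_nonneg) auto
  have ex: "\<exists>\<gamma> K. ?good e \<gamma> K" if e: "0 < e" for e
  proof -
    have "(?s powr (1 / p)) powr p < (?b + e / 2) powr p"
      using e p by (intro powr_less_mono2) auto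
    then have s: "?s < (?b + e / 2) powr p" using p s0 by (simp add: powr_powr)
    have "?a < ?a + e / 2" "0 < ?b + e / 2" using e by (auto intro: add_nonneg_pos)
    from coupling_add_kernel[OF p m J N this(1) s this(2)]
    obtain \<gamma> K where "\<gamma> \<in> couplings \<mu> \<nu>" "K \<in> borel \<rightarrow>\<^sub>M subprob_algebra (borel \<Otimes>\<^sub>M borel)"
      "\<forall>y. K y \<in> couplings \<mu>' (\<nu>' (J y))"
      "(\<integral>\<^sup>+z. ennreal (norm (snd z - fst z) powr p) \<partial>glue \<gamma> K) \<le> ennreal ((?a + e / 2 + (?b + e / 2)) powr p)" .
    then show ?thesis by (intro exI[of _ \<gamma>] exI[of _ K]) (simp add: algebra_simps)
  qed
  obtain \<gamma> K where gK: "?good 1 \<gamma> K" using ex[OF zero_less_one] by blast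
  have g0: "\<gamma> \<in> couplings \<mu> \<nu>" "K \<in> borel \<rightarrow>\<^sub>M subprob_algebra (borel \<Otimes>\<^sub>M borel)" "K y \<in> couplings \<mu>' (\<nu>' (J y))" for y
    using gK by blast+
  \<comment> \<open>Built from couplings with error 1. By \<open>emeasure_glue_snd\<close>,
    couplings with any other error have the same second marginal, so this one \<open>\<pi>\<close>
    satisfies the bound for every \<open>e\<close>.\<close>
  define \<pi> where "\<pi> = distr (glue \<gamma> K) borel snd"
  have step: "\<pi> \<in> prob_moment p \<and> wasserstein p ?\<mu> \<pi> \<le> ?a + ?b + e" if e: "0 < e" for e
  proof -
    obtain \<gamma>1 K1 where 1: "?good e \<gamma>1 K1" using ex[OF e] by blast
    have g1: "\<gamma>1 \<in> couplings \<mu> \<nu>" "K1 \<in> borel \<rightarrow>\<^sub>M subprob_algebra (borel \<Otimes>\<^sub>M borel)" "K1 y \<in> couplings \<mu>' (\<nu>' (J y))" for y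
      using 1 by blast+
    have cost: "(\<integral>\<^sup>+z. ennreal (norm (snd z - fst z) powr p) \<partial>glue \<gamma>1 K1) \<le> ennreal ((?a + ?b + e) powr p)"
      using 1 by blast
    have eq: "\<pi> = distr (glue \<gamma>1 K1) borel snd"
      unfolding \<pi>_def
    proof (rule measure_eqI)
      fix A assume "A \<in> sets (distr (glue \<gamma> K) borel snd)"
      then have A: "A \<in> sets borel" by simp
      show "emeasure (distr (glue \<gamma> K) borel snd) A = emeasure (distr (glue \<gamma>1 K1) borel snd) A"
        unfolding emeasure_glue_snd[OF g0 A] emeasure_glue_snd[OF g1 A] ..
    qed simp
    have c: "glue \<gamma>1 K1 \<in> couplings ?\<mu> \<pi>"
      unfolding eq by (rule glue_coupling[OF g1])
    have int: "integrable (glue \<gamma>1 K1) (\<lambda>z. norm (snd z - fst z) powr p)"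
    proof (rule integrableI_nonneg)
      show "(\<integral>\<^sup>+z. ennreal (norm (snd z - fst z) powr p) \<partial>glue \<gamma>1 K1) < \<infinity>"
        using le_less_trans[OF cost ennreal_less_top] by simp
      show "(\<lambda>z. norm (snd z - fst z) powr p) \<in> borel_measurable (glue \<gamma>1 K1)"
        unfolding measurable_cong_sets[OF couplingsD(2)[OF c] refl] by measurable
    qed simp
    have "ennreal (\<integral>z. norm (snd z - fst z) powr p \<partial>glue \<gamma>1 K1) \<le> ennreal ((?a + ?b + e) powr p)"
      using cost nn_integral_eq_integral[OF int] by simp
    then have le: "(\<integral>z. norm (snd z - fst z) powr p \<partial>glue \<gamma>1 K1) \<le> (?a + ?b + e) powr p"
      by simp
    have "0 \<le> ?a + ?b + e" using e wasserstein_nonneg[OF m(1,2)] by simp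
    from wasserstein_le[OF p1 c this le] coupling_snd_moment[OF p1 m_add c int] show ?thesis by blast
  qed
  show ?thesis
  proof (rule that)
    show "\<pi> \<in> prob_moment p" using step[of 1] by simp
    show "wasserstein p ?\<mu> \<pi> \<le> ?a + ?b" by (rule field_le_epsilon) (use step in auto)
    show "\<forall>h B. h \<in> borel_measurable borel \<longrightarrow> (\<forall>z. \<bar>h z\<bar> \<le> (B::real)) \<longrightarrow>
      (\<integral>z. h z \<partial>\<pi>) = (\<integral>y. \<integral>z. h (y + z) \<partial>\<nu>' (J y) \<partial>\<nu>) \<and>
      (\<lambda>y. \<integral>z. h (y + z) \<partial>\<nu>' (J y)) \<in> borel_measurable borel"
      unfolding \<pi>_def by (auto intro!: integral_glue_snd[OF g0])
  qed
qed

section \<open>The perturbed operators\<close>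

text \<open>The class in which the iteration takes place. It contains \<open>C0\<close>, and its
  invariance under \<open>pert\<close> follows by comparing translates, whereas invariance of
  \<open>C0\<close> would involve the decay at infinity.\<close>

definition bounded_ucont :: "('a::euclidean_space \<Rightarrow> real) \<Rightarrow> bool" where
  "bounded_ucont f \<longleftrightarrow> bounded (range f) \<and> uniformly_continuous_on UNIV f"

lemma bounded_ucontE:
  assumes "bounded_ucont f"
  obtains B where "0 \<le> B" "\<And>x. \<bar>f x\<bar> \<le> B"
proof -
  obtain B where "\<And>x. \<bar>f x\<bar> \<le> B" using assms unfolding bounded_ucont_def bounded_iff by auto
  moreover from this[of 0] have "0 \<le> B" by linarith
  ultimately show ?thesis using that by blast
qed

lemma bounded_ucont_measurable:
  assumes "bounded_ucont f"
  shows "f \<in> borel_measurable borel"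
  using assms unfolding bounded_ucont_def
  by (intro borel_measurable_continuous_onI uniformly_continuous_imp_continuous) auto

lemma bounded_ucont_C0: "f \<in> C0 \<Longrightarrow> bounded_ucont f"
  unfolding bounded_ucont_def C0_def
  using uniformly_continuous_vanishing_at_infinity[of f] bounded_range_vanishing_at_infinity[of f] by auto

lemma integrable_bounded_translate:
  fixes f :: "'a::euclidean_space \<Rightarrow> real"
  assumes "prob_space \<nu>" and s: "sets \<nu> = sets borel"
    and [measurable]: "f \<in> borel_measurable borel" and B: "\<And>x. \<bar>f x\<bar> \<le> B"
  shows "integrable \<nu> (\<lambda>y. f (x + y))"
proof -
  interpret prob_space \<nu> by fact
  note [measurable_cong] = s
  show ?thesis by (rule integrable_const_bound[of _ B]) (auto simp: B)
qed

text \<open>A non-integrable \<open>g\<close> has Bochner integral 0, which \<open>0 \<le> B\<close>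
  covers; so the bound applies without a measurability check.\<close>

lemma integral_le_bound:
  fixes g :: "'a \<Rightarrow> real"
  assumes "prob_space \<nu>" "\<And>y. g y \<le> B" "0 \<le> B"
  shows "(\<integral>y. g y \<partial>\<nu>) \<le> B"
proof (cases "integrable \<nu> g")
  case True
  interpret prob_space \<nu> by fact
  have "(\<integral>y. g y \<partial>\<nu>) \<le> (\<integral>y. B \<partial>\<nu>)" by (intro integral_mono) (use True assms in auto)
  then show ?thesis by (simp add: prob_space)
qed (simp add: not_integrable_integral_eq assms)

lemma abs_integral_le_bound:
  fixes g :: "'a \<Rightarrow> real"
  assumes "prob_space \<nu>" "\<And>y. \<bar>g y\<bar> \<le> B"
  shows "\<bar>\<integral>y. g y \<partial>\<nu>\<bar> \<le> B"
proof -
  have B: "0 \<le> B" using assms(2)[of undefined] by linarith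
  have "g y \<le> B" "- g y \<le> B" for y using assms(2)[of y] by linarith+
  from integral_le_bound[OF assms(1), of g B] integral_le_bound[OF assms(1), of "\<lambda>y. - g y" B] this B
  show ?thesis by simp
qed

text \<open>Convexity expressed through real upper bounds, that is, convexity of the epigraph. This
  keeps the value \<open>\<infinity>\<close> of \<open>\<phi>\<close> out of later
  arithmetic.\<close>

lemma convex_epigraph_add:
  assumes "ereal_convex_on {0..} h" "0 \<le> x" "0 \<le> y" "0 \<le> u" "0 \<le> v" "u + v = 1"
    and "h x \<le> ereal r" "h y \<le> ereal s"
  shows "h (u * x + v * y) \<le> ereal (u * r + v * s)"
proof -
  have "h (u * x + v * y) \<le> ereal u * h x + ereal v * h y"
    using assms(1-6) unfolding ereal_convex_on_def by auto
  also have "\<dots> \<le> ereal u * ereal r + ereal v * ereal s"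
    using assms by (intro add_mono ereal_mult_left_mono) auto
  finally show ?thesis by simp
qed

text \<open>What the short-time analysis takes from the process: moments, the convolution property
  and concentration at the origin. Times stay in the unit interval, where the moments come from that
  of \<open>\<mu> 1\<close>; this suffices for a limit at 0.\<close>

locale wasserstein_perturbation =
  fixes p :: real and \<phi> :: "real \<Rightarrow> ereal" and \<mu> :: "real \<Rightarrow> 'a::euclidean_space measure"
  assumes p_gt_1: "1 < p"
    and mu_moment: "\<And>t. \<lbrakk>0 \<le> t; t \<le> 1\<rbrakk> \<Longrightarrow> \<mu> t \<in> prob_moment p"
    and mu_add: "\<And>s t. \<lbrakk>0 \<le> s; 0 \<le> t; s + t \<le> 1\<rbrakk> \<Longrightarrow>
      distr (\<mu> s \<Otimes>\<^sub>M \<mu> t) borel (\<lambda>z. fst z + snd z) = \<mu> (s + t)"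
    and mu_vanish: "\<And>e. 0 < e \<Longrightarrow> ((\<lambda>t. measure (\<mu> t) {x. e < norm x}) \<longlongrightarrow> 0) (at_right 0)"
    and phi_nonneg: "\<And>x. 0 \<le> x \<Longrightarrow> 0 \<le> \<phi> x"
    and phi_convex: "ereal_convex_on {0..} \<phi>"
    and phi_mono: "mono_on {0..} \<phi>"
    and phi_nonzero: "\<exists>x\<ge>0. 0 < \<phi> x"
    and phi_zero: "\<phi> 0 = 0"
    and phi_powr_convex: "ereal_convex_on {0..} (\<lambda>x. \<phi> (x powr (1 / p)))"
begin

abbreviation S :: "real \<Rightarrow> ('a \<Rightarrow> real) \<Rightarrow> 'a \<Rightarrow> real" where
  "S \<equiv> pert p \<phi> \<mu>"

abbreviation W :: "'a measure \<Rightarrow> 'a measure \<Rightarrow> real" where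
  "W \<equiv> wasserstein p"

lemma perspective_le_iff:
  assumes "0 < t"
  shows "perspective \<phi> t a \<le> ereal r \<longleftrightarrow> \<phi> (a / t) \<le> ereal (r / t)"
  using assms by (cases "\<phi> (a / t)") (auto simp: perspective_def field_simps)

lemma perspective_nonneg: "0 \<le> t \<Longrightarrow> 0 \<le> a \<Longrightarrow> 0 \<le> perspective \<phi> t a"
  using phi_nonneg[of "a / t"] by (auto simp: perspective_def)

lemma perspective_mono:
  assumes "0 \<le> t" "0 \<le> a" "a \<le> b"
  shows "perspective \<phi> t a \<le> perspective \<phi> t b"
proof (cases "0 < t")
  case True
  then have "\<phi> (a / t) \<le> \<phi> (b / t)"
    using assms by (intro mono_onD[OF phi_mono]) (auto simp: divide_right_mono)
  then show ?thesis using True by (simp add: perspective_def ereal_mult_left_mono)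
qed (use assms in \<open>auto simp: perspective_def\<close>)

lemma perspective_zero: "perspective \<phi> t 0 = 0"
  by (simp add: perspective_def phi_zero)

text \<open>The perspective of a convex function is jointly convex and positively homogeneous, hence
  subadditive: \<open>(a + b) / (s + t)\<close> is the convex combination of \<open>a / s\<close>
  and \<open>b / t\<close> with weights proportional to the times. A vanishing time forces a
  vanishing distance.\<close>

lemma perspective_add:
  assumes st: "0 \<le> s" "0 \<le> t" and ab: "0 \<le> a" "0 \<le> b"
    and le: "perspective \<phi> s a \<le> ereal r" "perspective \<phi> t b \<le> ereal q"
  shows "perspective \<phi> (s + t) (a + b) \<le> ereal (r + q)"
proof -
  have rq: "0 \<le> r" "0 \<le> q"
    using order_trans[OF perspective_nonneg le(1)] order_trans[OF perspective_nonneg le(2)] st ab by auto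
  consider "s = 0" | "t = 0" | "0 < s" "0 < t" using st by fastforce
  then show ?thesis
  proof cases
    case 1
    then have "a = 0" using le(1) by (auto simp: perspective_def split: if_splits)
    then show ?thesis using le(2) 1 rq by (auto intro: order_trans)
  next
    case 2
    then have "b = 0" using le(2) by (auto simp: perspective_def split: if_splits)
    then show ?thesis using le(1) 2 rq by (auto intro: order_trans)
  next
    case 3
    have "\<phi> (s / (s + t) * (a / s) + t / (s + t) * (b / t)) \<le> ereal (s / (s + t) * (r / s) + t / (s + t) * (q / t))"
      using 3 ab le by (intro convex_epigraph_add[OF phi_convex]) (auto simp: perspective_le_iff add_divide_distrib[symmetric])
    then show ?thesis using 3 by (simp add: perspective_le_iff add_divide_distrib)
  qed
qed

text \<open>Jensen's inequality for \<open>x \<mapsto> \<phi> (x powr (1 / p))\<close> at the points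
  \<open>(b i / t) powr p\<close>, carried out as convexity of the epigraph \<open>E\<close> in the
  plane.\<close>

lemma perspective_jensen:
  fixes w b r :: "'i \<Rightarrow> real"
  assumes t: "0 \<le> t" and I: "finite I" and w: "\<And>i. i \<in> I \<Longrightarrow> 0 \<le> w i" "sum w I = 1"
    and b: "\<And>i. i \<in> I \<Longrightarrow> 0 \<le> b i" and r: "\<And>i. i \<in> I \<Longrightarrow> perspective \<phi> t (b i) \<le> ereal (r i)"
  shows "perspective \<phi> t ((\<Sum>i\<in>I. w i * b i powr p) powr (1 / p)) \<le> ereal (\<Sum>i\<in>I. w i * r i)"
proof (cases "0 < t")
  case False
  then have "b i = 0" "0 \<le> r i" if "i \<in> I" for i
    using t r[OF that] by (auto simp: perspective_def split: if_splits)
  then show ?thesis using w by (auto simp: perspective_zero intro!: sum_nonneg)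
next
  case t: True
  define E where "E = {(x, q) :: real \<times> real | x q. 0 \<le> x \<and> \<phi> (x powr (1 / p)) \<le> ereal q}"
  have "convex E"
  proof (rule convexI)
    fix y z :: "real \<times> real" and u v :: real
    assume "y \<in> E" "z \<in> E" and uv: "0 \<le> u" "0 \<le> v" "u + v = 1"
    then obtain x1 q1 x2 q2 where "y = (x1, q1)" "z = (x2, q2)" "0 \<le> x1" "0 \<le> x2"
      "\<phi> (x1 powr (1 / p)) \<le> ereal q1" "\<phi> (x2 powr (1 / p)) \<le> ereal q2"
      unfolding E_def by auto
    then show "u *\<^sub>R y + v *\<^sub>R z \<in> E"
      using convex_epigraph_add[OF phi_powr_convex _ _ uv, of x1 x2 q1 q2] uv
      by (auto simp: E_def intro: add_nonneg_nonneg)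
  qed
  moreover have "((b i / t) powr p, r i / t) \<in> E" if "i \<in> I" for i
    using r[OF that] b[OF that] t p_gt_1 by (auto simp: E_def perspective_le_iff powr_powr)
  ultimately have "(\<Sum>i\<in>I. w i *\<^sub>R ((b i / t) powr p, r i / t)) \<in> E"
    using w I by (intro convex_sum) auto
  also have "(\<Sum>i\<in>I. w i *\<^sub>R ((b i / t) powr p, r i / t))
      = ((\<Sum>i\<in>I. w i * b i powr p) / t powr p, (\<Sum>i\<in>I. w i * r i) / t)"
    using b t by (simp add: sum_prod[symmetric] sum_divide_distrib powr_divide prod_eq_iff fst_sum snd_sum)
  finally have "\<phi> (((\<Sum>i\<in>I. w i * b i powr p) / t powr p) powr (1 / p)) \<le> ereal ((\<Sum>i\<in>I. w i * r i) / t)"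
    by (simp add: E_def)
  also have "((\<Sum>i\<in>I. w i * b i powr p) / t powr p) powr (1 / p) = (\<Sum>i\<in>I. w i * b i powr p) powr (1 / p) / t"
    using w t p_gt_1 by (simp add: powr_divide sum_nonneg powr_powr)
  finally show ?thesis using t by (simp add: perspective_le_iff)
qed

section \<open>Elementary properties of the one-step operator\<close>

context
  fixes t B :: real and f :: "'a \<Rightarrow> real"
  assumes t: "0 \<le> t" "t \<le> 1" and B: "\<And>x. \<bar>f x\<bar> \<le> B"
begin

private lemma integral_bound: "\<nu> \<in> prob_moment p \<Longrightarrow> \<bar>\<integral>y. f (x + y) \<partial>\<nu>\<bar> \<le> B"
  by (rule abs_integral_le_bound) (auto simp: prob_momentD B)

private lemma perspective_nn: "\<nu> \<in> prob_moment p \<Longrightarrow> 0 \<le> perspective \<phi> t (W (\<mu> t) \<nu>)"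
  using perspective_nonneg wasserstein_nonneg[OF mu_moment] t by simp

lemma ereal_pert:
  "ereal (S t f x) = (SUP \<nu>\<in>prob_moment p. ereal (\<integral>y. f (x + y) \<partial>\<nu>) - perspective \<phi> t (W (\<mu> t) \<nu>))"
proof -
  let ?s = "SUP \<nu>\<in>prob_moment p. ereal (\<integral>y. f (x + y) \<partial>\<nu>) - perspective \<phi> t (W (\<mu> t) \<nu>)"
  have "?s \<le> ereal B"
  proof (rule SUP_least)
    fix \<nu> :: "'a measure" assume n: "\<nu> \<in> prob_moment p"
    show "ereal (\<integral>y. f (x + y) \<partial>\<nu>) - perspective \<phi> t (W (\<mu> t) \<nu>) \<le> ereal B"
      using integral_bound[OF n, of x] perspective_nn[OF n]
      by (cases "perspective \<phi> t (W (\<mu> t) \<nu>)") auto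
  qed
  moreover have "ereal (- B) \<le> ?s"
  proof (rule SUP_upper2)
    show "\<mu> t \<in> prob_moment p" using t by (rule mu_moment)
    then show "ereal (- B) \<le> ereal (\<integral>y. f (x + y) \<partial>\<mu> t) - perspective \<phi> t (W (\<mu> t) (\<mu> t))"
      using integral_bound[of "\<mu> t" x] p_gt_1 by (simp add: wasserstein_refl perspective_zero)
  qed
  ultimately have "\<bar>?s\<bar> \<noteq> \<infinity>" by auto
  then show ?thesis unfolding pert_def by (simp add: ereal_real')
qed

lemma pert_ge:
  assumes n: "\<nu> \<in> prob_moment p" and c: "perspective \<phi> t (W (\<mu> t) \<nu>) \<le> ereal c"
  shows "(\<integral>y. f (x + y) \<partial>\<nu>) - c \<le> S t f x"
proof -
  have "ereal ((\<integral>y. f (x + y) \<partial>\<nu>) - c) \<le> ereal (\<integral>y. f (x + y) \<partial>\<nu>) - perspective \<phi> t (W (\<mu> t) \<nu>)"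
    using c perspective_nn[OF n] by (cases "perspective \<phi> t (W (\<mu> t) \<nu>)") auto
  also have "\<dots> \<le> ereal (S t f x)" unfolding ereal_pert using n by (rule SUP_upper)
  finally show ?thesis by simp
qed

lemma pert_approx:
  assumes e: "0 < e"
  obtains \<nu> c where "\<nu> \<in> prob_moment p" "0 \<le> c" "perspective \<phi> t (W (\<mu> t) \<nu>) = ereal c"
    "S t f x < (\<integral>y. f (x + y) \<partial>\<nu>) - c + e"
proof -
  have "ereal (S t f x - e) < ereal (S t f x)" using e by simp
  then obtain \<nu> where n: "\<nu> \<in> prob_moment p"
    and l: "ereal (S t f x - e) < ereal (\<integral>y. f (x + y) \<partial>\<nu>) - perspective \<phi> t (W (\<mu> t) \<nu>)"
    unfolding ereal_pert less_SUP_iff by blast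
  with perspective_nn[OF n] show ?thesis
    by (cases "perspective \<phi> t (W (\<mu> t) \<nu>)") (auto intro!: that[OF n])
qed

lemma pert_le:
  assumes "\<And>\<nu> c. \<lbrakk>\<nu> \<in> prob_moment p; 0 \<le> c; perspective \<phi> t (W (\<mu> t) \<nu>) = ereal c\<rbrakk>
    \<Longrightarrow> (\<integral>y. f (x + y) \<partial>\<nu>) - c \<le> C"
  shows "S t f x \<le> C"
proof (rule field_le_epsilon)
  fix e :: real assume "0 < e"
  from pert_approx[OF this, of x] obtain \<nu> c where "\<nu> \<in> prob_moment p" "0 \<le> c"
    "perspective \<phi> t (W (\<mu> t) \<nu>) = ereal c" "S t f x < (\<integral>y. f (x + y) \<partial>\<nu>) - c + e" .
  with assms[OF this(1-3)] show "S t f x \<le> C + e" by linarith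
qed

lemma abs_pert_le: "\<bar>S t f x\<bar> \<le> B"
proof -
  have m: "\<mu> t \<in> prob_moment p" using t by (rule mu_moment)
  have "(\<integral>y. f (x + y) \<partial>\<mu> t) - 0 \<le> S t f x"
    using p_gt_1 by (intro pert_ge m) (simp add: wasserstein_refl[OF _ m] perspective_zero)
  moreover have "S t f x \<le> B"
  proof (rule pert_le)
    fix \<nu> :: "'a measure" and c :: real assume "\<nu> \<in> prob_moment p" "0 \<le> c"
    with integral_bound[OF this(1), of x] show "(\<integral>y. f (x + y) \<partial>\<nu>) - c \<le> B" by linarith
  qed
  ultimately show ?thesis using integral_bound[OF m, of x] by linarith
qed

end

text \<open>The penalty does not involve the base point, so the same competitors serve at
  \<open>x\<close> and at \<open>x'\<close>. With \<open>x = x'\<close> and \<open>e = 0\<close>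
  this is monotonicity; with \<open>f = g\<close> it transfers a modulus of continuity.\<close>

lemma pert_le_translate:
  assumes t: "0 \<le> t" "t \<le> 1"
    and f: "f \<in> borel_measurable borel" "\<And>x. \<bar>f x\<bar> \<le> B" and g: "g \<in> borel_measurable borel" "\<And>x. \<bar>g x\<bar> \<le> B'"
    and le: "\<And>y. f (x + y) \<le> g (x' + y) + e"
  shows "S t f x \<le> S t g x' + e"
proof (rule pert_le[OF t f(2)])
  fix \<nu> c assume n: "\<nu> \<in> prob_moment p" "0 \<le> c" "perspective \<phi> t (W (\<mu> t) \<nu>) = ereal c"
  note d = prob_momentD[OF n(1)]
  interpret prob_space \<nu> by (fact d)
  have "(\<integral>y. f (x + y) \<partial>\<nu>) \<le> (\<integral>y. g (x' + y) + e \<partial>\<nu>)"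
    using integrable_bounded_translate[OF d(1,2) f] integrable_bounded_translate[OF d(1,2) g] le
    by (intro integral_mono) auto
  also have "\<dots> = (\<integral>y. g (x' + y) \<partial>\<nu>) + e"
    using integrable_bounded_translate[OF d(1,2) g] by (simp add: prob_space)
  finally have "(\<integral>y. f (x + y) \<partial>\<nu>) \<le> (\<integral>y. g (x' + y) \<partial>\<nu>) + e" .
  moreover have "(\<integral>y. g (x' + y) \<partial>\<nu>) - c \<le> S t g x'"
    by (rule pert_ge[OF t g(2) n(1)]) (simp add: n(3))
  ultimately show "(\<integral>y. f (x + y) \<partial>\<nu>) - c \<le> S t g x' + e" by linarith
qed

lemma pert_mono:
  assumes t: "0 \<le> t" "t \<le> 1" and fg: "bounded_ucont f" "bounded_ucont g" and le: "\<And>x. f x \<le> g x"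
  shows "S t f x \<le> S t g x"
proof -
  obtain B B' where "\<And>x. \<bar>f x\<bar> \<le> B" "\<And>x. \<bar>g x\<bar> \<le> B'" by (metis fg bounded_ucontE)
  then show ?thesis
    using pert_le_translate[OF t bounded_ucont_measurable[OF fg(1)] _ bounded_ucont_measurable[OF fg(2)], of B B' x x 0] le
    by simp
qed

lemma bounded_ucont_pert:
  assumes t: "0 \<le> t" "t \<le> 1" and f: "bounded_ucont f"
  shows "bounded_ucont (S t f)"
proof -
  note m = bounded_ucont_measurable[OF f]
  obtain B where B: "\<And>x. \<bar>f x\<bar> \<le> B" by (metis f bounded_ucontE)
  have "bounded (range (S t f))"
    using abs_pert_le[OF t B] by (intro boundedI[of _ B]) auto
  moreover have "uniformly_continuous_on UNIV (S t f)"
    unfolding uniformly_continuous_on_def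
  proof (intro allI impI)
    fix e :: real assume e: "0 < e"
    then obtain d where d: "0 < d" "\<And>x x'. dist x' x < d \<Longrightarrow> dist (f x') (f x) < e / 2"
      using f unfolding bounded_ucont_def uniformly_continuous_on_def by (metis half_gt_zero UNIV_I)
    have le: "S t f x' \<le> S t f x + e / 2" if "dist x' x < d" for x x'
    proof (rule pert_le_translate[OF t m B m B])
      fix y
      have "dist (x' + y) (x + y) < d" using that by (simp add: dist_norm)
      from d(2)[OF this] show "f (x' + y) \<le> f (x + y) + e / 2" unfolding dist_real_def by linarith
    qed
    have "dist (S t f x') (S t f x) < e" if "dist x' x < d" for x x'
      using le[OF that] le[of x x'] that e by (auto simp: dist_commute dist_real_def)
    with d(1) show "\<exists>d>0. \<forall>x\<in>UNIV. \<forall>x'\<in>UNIV. dist x' x < d \<longrightarrow> dist (S t f x') (S t f x) < e" by auto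
  qed
  ultimately show ?thesis unfolding bounded_ucont_def by blast
qed

end

section \<open>Two steps compared with one\<close>

context wasserstein_perturbation
begin

text \<open>Half of the error \<open>e\<close> pays for the piecewise constant choice of second
  steps on a large ball. The other half pays for the mass of \<open>\<nu>\<close> outside it, where
  only the trivial bound \<open>2 * B\<close> is used.\<close>

lemma pert_pert_le:
  assumes st: "0 \<le> s" "0 \<le> t" "s + t \<le> 1" and f: "bounded_ucont f"
  shows "S s (S t f) x \<le> S (s + t) f x"
proof (rule field_le_epsilon)
  fix e :: real assume e: "0 < e"
  have s1: "s \<le> 1" and t1: "t \<le> 1" and st0: "0 \<le> s + t" using st by auto
  have p1: "1 \<le> p" using p_gt_1 by simp
  note mf = bounded_ucont_measurable[OF f]
  obtain B where B: "0 \<le> B" "\<And>x. \<bar>f x\<bar> \<le> B" by (metis f bounded_ucontE)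
  define g where "g = S t f"
  have gB: "\<bar>g x\<bar> \<le> B" for x unfolding g_def by (rule abs_pert_le[OF st(2) t1 B(2)])
  have mg: "g \<in> borel_measurable borel"
    unfolding g_def by (intro bounded_ucont_measurable bounded_ucont_pert st t1 f)
  obtain d where d: "0 < d" "\<And>x x'. dist x' x < d \<Longrightarrow> dist (f x') (f x) < e / 8"
    using f e unfolding bounded_ucont_def uniformly_continuous_on_def
    by (metis UNIV_I divide_pos_pos zero_less_numeral)
  have fd: "f (z' + y) \<le> f (z + y) + e / 8" if "dist z' z < d" for z z' y
  proof -
    have "dist (z' + y) (z + y) < d" using that by (simp add: dist_norm)
    from d(2)[OF this] show ?thesis unfolding dist_real_def by linarith
  qed
  have gd: "g z' \<le> g z + e / 8" if "dist z' z < d" for z z'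
    unfolding g_def by (rule pert_le_translate[OF st(2) t1 mf B(2) mf B(2) fd[OF that]])
  have "S s g x \<le> S (s + t) f x + e"
  proof (rule pert_le[OF st(1) s1 gB])
    fix \<nu> c assume n: "\<nu> \<in> prob_moment p" "0 \<le> c" "perspective \<phi> s (W (\<mu> s) \<nu>) = ereal c"
    note nd = prob_momentD[OF n(1)]
    interpret N: prob_space \<nu> by (fact nd)
    note [measurable_cong] = nd(2)
    have sp: "space \<nu> = UNIV" using sets_eq_imp_space_eq[OF nd(2)] by simp
    have "(\<lambda>n. measure \<nu> {y. real n < norm y}) \<longlonglongrightarrow> measure \<nu> (\<Inter>n. {y. real n < norm y})"
    proof (rule N.finite_Lim_measure_decseq)
      show "range (\<lambda>n. {y :: 'a. real n < norm y}) \<subseteq> sets \<nu>" by (auto simp: nd(2))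
    qed (auto simp: decseq_def)
    also have "(\<Inter>n. {y :: 'a. real n < norm y}) = {}"
    proof -
      have "\<not> (\<forall>n. real n < norm y)" for y :: 'a
        using real_arch_simple[of "norm y"] by (meson not_less)
      then show ?thesis by blast
    qed
    finally have "(\<lambda>n. measure \<nu> {y. real n < norm y}) \<longlonglongrightarrow> 0" by simp
    \<comment> \<open>The summand 1 keeps the denominator positive when
      \<open>B = 0\<close>.\<close>
    then have "\<forall>\<^sub>F n in sequentially. measure \<nu> {y. real n < norm y} < e / (4 * (B + 1))"
      using e B by (intro order_tendstoD) auto
    then obtain n0 where "measure \<nu> {y. real n0 < norm y} < e / (4 * (B + 1))"
      by (auto simp: eventually_sequentially)
    then obtain R :: real where R: "measure \<nu> {y. R < norm y} < e / (4 * (B + 1))" by blast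
    have "measure \<nu> {y. R < norm y} * (4 * (B + 1)) < e"
      using R B(1) by (simp add: pos_less_divide_eq)
    moreover have "0 \<le> measure \<nu> {y. R < norm y}" by simp
    moreover have "measure \<nu> {y. R < norm y} * (4 * (B + 1))
        = 2 * (2 * B * measure \<nu> {y. R < norm y}) + 4 * measure \<nu> {y. R < norm y}"
      by (simp add: algebra_simps)
    ultimately have tail: "2 * B * measure \<nu> {y. R < norm y} \<le> e / 2" by linarith
    obtain k :: "'a set" where k: "finite k" "cball 0 R \<subseteq> (\<Union>y\<in>k. ball y d)"
      using iffD1[OF compact_eq_totally_bounded compact_cball[of "0::'a" R], THEN conjunct2, rule_format, OF d(1)] by blast
    obtain cs where cs: "set cs = k" using finite_list[OF k(1)] by blast
    define N where "N = length cs"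
    \<comment> \<open>The first centre of the \<open>d\<close>-net close to \<open>y\<close>. The
      default \<open>N\<close> marks points that no centre reaches; since \<open>N\<close> always
      satisfies the predicate, the minimum exists.\<close>
    define J where "J y = (LEAST i. i = N \<or> (i < N \<and> dist (cs ! i) y < d))" for y
    have J_meas[measurable]: "J \<in> borel \<rightarrow>\<^sub>M count_space UNIV"
      unfolding J_def by measurable
    have JN: "J y \<le> N" for y unfolding J_def by (rule Least_le) simp
    have JP: "J y = N \<or> (J y < N \<and> dist (cs ! J y) y < d)" for y
      unfolding J_def by (rule LeastI[of _ N]) simp
    have Jout: "R < norm y" if "J y = N" for y
    proof (rule ccontr)
      assume "\<not> R < norm y"
      then have "y \<in> cball 0 R" by simp
      with k(2) cs obtain c where "c \<in> set cs" "dist c y < d" by auto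
      then obtain i where "i < N" "dist (cs ! i) y < d" by (auto simp: in_set_conv_nth N_def)
      then have "J y \<le> i" unfolding J_def by (intro Least_le) simp
      with that \<open>i < N\<close> show False by simp
    qed
    \<comment> \<open>At a centre, a near-optimal law for the base point \<open>x + cs ! i\<close>;
      at all other indices, in particular the default \<open>N\<close>, the law
      \<open>\<mu> t\<close> at cost 0.\<close>
    have "\<exists>\<nu>' c'. \<nu>' \<in> prob_moment p \<and> 0 \<le> c' \<and> perspective \<phi> t (W (\<mu> t) \<nu>') \<le> ereal c' \<and>
        (if i < N then g (x + cs ! i) < (\<integral>y. f (x + cs ! i + y) \<partial>\<nu>') - c' + e / 8 else c' = 0)" for i
    proof (cases "i < N")
      case True
      from pert_approx[where f = f and x = "x + cs ! i" and e = "e / 8", OF st(2) t1 B(2)] e obtain \<nu>' c' where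
        "\<nu>' \<in> prob_moment p" "0 \<le> c'" "perspective \<phi> t (W (\<mu> t) \<nu>') = ereal c'"
        "g (x + cs ! i) < (\<integral>y. f (x + cs ! i + y) \<partial>\<nu>') - c' + e / 8" unfolding g_def by auto
      with True show ?thesis by (intro exI[of _ \<nu>'] exI[of _ c']) auto
    next
      case False
      have "W (\<mu> t) (\<mu> t) = 0" by (intro wasserstein_refl p1 mu_moment st t1)
      with False show ?thesis
        by (intro exI[of _ "\<mu> t"] exI[of _ 0]) (auto simp: perspective_zero intro!: mu_moment st t1)
    qed
    then obtain \<nu>' c' where n': "\<And>i. \<nu>' i \<in> prob_moment p" "\<And>i. 0 \<le> c' i"
      "\<And>i. perspective \<phi> t (W (\<mu> t) (\<nu>' i)) \<le> ereal (c' i)"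
      "\<And>i. if i < N then g (x + cs ! i) < (\<integral>y. f (x + cs ! i + y) \<partial>\<nu>' i) - c' i + e / 8 else c' i = 0"
      by metis
    have mm: "\<mu> s \<in> prob_moment p" "\<mu> t \<in> prob_moment p" "\<mu> (s + t) \<in> prob_moment p"
      using st s1 t1 by (auto intro!: mu_moment)
    note madd = mu_add[OF st]
    have madd_mm: "distr (\<mu> s \<Otimes>\<^sub>M \<mu> t) borel (\<lambda>z. fst z + snd z) \<in> prob_moment p"
      using mm madd by simp
    obtain \<pi> where pi: "\<pi> \<in> prob_moment p"
      "W (\<mu> (s + t)) \<pi> \<le> W (\<mu> s) \<nu> + (\<Sum>i\<le>N. measure \<nu> {y. J y = i} * W (\<mu> t) (\<nu>' i) powr p) powr (1 / p)"
      and pi_int: "\<forall>h B. h \<in> borel_measurable borel \<longrightarrow> (\<forall>z. \<bar>h z\<bar> \<le> (B::real)) \<longrightarrow>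
        (\<integral>z. h z \<partial>\<pi>) = (\<integral>y. \<integral>z. h (y + z) \<partial>\<nu>' (J y) \<partial>\<nu>) \<and>
        (\<lambda>y. \<integral>z. h (y + z) \<partial>\<nu>' (J y)) \<in> borel_measurable borel"
      using wasserstein_add_kernel[where \<nu>' = \<nu>' and J = J, OF p_gt_1 mm(1) n(1) mm(2) n'(1) madd_mm J_meas JN]
      unfolding madd by blast
    let ?w = "\<lambda>i. measure \<nu> {y. J y = i}"
    have w1: "(\<Sum>i\<le>N. ?w i) = 1"
      using integral_finite_index(2)[where J = J and \<kappa> = "\<lambda>_. 1", OF N.prob_space_axioms _ JN] N.prob_space by (simp add: sp)
    have "perspective \<phi> (s + t) (W (\<mu> (s + t)) \<pi>)
        \<le> perspective \<phi> (s + t) (W (\<mu> s) \<nu> + (\<Sum>i\<le>N. ?w i * W (\<mu> t) (\<nu>' i) powr p) powr (1 / p))"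
      by (intro perspective_mono st0 wasserstein_nonneg mm pi)
    also have "\<dots> \<le> ereal (c + (\<Sum>i\<le>N. ?w i * c' i))"
    proof (rule perspective_add)
      show "perspective \<phi> t ((\<Sum>i\<le>N. ?w i * W (\<mu> t) (\<nu>' i) powr p) powr (1 / p)) \<le> ereal (\<Sum>i\<le>N. ?w i * c' i)"
        by (rule perspective_jensen) (use st w1 n' mm in \<open>auto intro!: wasserstein_nonneg\<close>)
    qed (use st n in \<open>auto intro!: wasserstein_nonneg mm\<close>)
    finally have main: "(\<integral>y. f (x + y) \<partial>\<pi>) - (c + (\<Sum>i\<le>N. ?w i * c' i)) \<le> S (s + t) f x"
      by (intro pert_ge[OF st0 st(3) B(2) pi(1)])
    define G where "G y = (\<integral>z. f (x + (y + z)) \<partial>\<nu>' (J y))" for y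
    have mfx: "(\<lambda>y. f (x + y)) \<in> borel_measurable borel" using mf by measurable
    have pint: "(\<integral>y. f (x + y) \<partial>\<pi>) = (\<integral>y. G y \<partial>\<nu>)"
      using pi_int[rule_format, OF mfx B(2)] by (simp add: G_def)
    have mG: "G \<in> borel_measurable borel" using pi_int[rule_format, OF mfx B(2)] by (simp add: G_def[abs_def])
    have GB: "\<bar>G y\<bar> \<le> B" for y
      unfolding G_def using B prob_momentD(1)[OF n'(1)] by (intro abs_integral_le_bound) auto
    \<comment> \<open>Near a centre three errors of \<open>e / 8\<close> arise: near-optimality of
      the law, the change of base point in \<open>f\<close>, and that in \<open>g\<close>. On the
      default piece the indicator is 1 and covers the difference of two values bounded by
      \<open>B\<close>.\<close>
    have G_ge: "g (x + y) + c' (J y) - e / 2 - 2 * B * indicator {y. R < norm y} y \<le> G y" for y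
    proof (cases "J y = N")
      case True
      then show ?thesis using Jout[OF True] GB[of y] gB[of "x + y"] n'(4)[of "J y"] e by simp
    next
      case False
      then have J: "J y < N" "dist (cs ! J y) y < d" using JP[of y] by auto
      note nJ = prob_momentD[OF n'(1)[of "J y"]]
      interpret NJ: prob_space "\<nu>' (J y)" by (fact nJ)
      have dd: "dist (x + cs ! J y) (x + y) < d" "dist (x + y) (x + cs ! J y) < d"
        using J(2) by (simp_all add: dist_commute)
      have "(\<integral>z. f (x + cs ! J y + z) \<partial>\<nu>' (J y)) \<le> (\<integral>z. f (x + y + z) + e / 8 \<partial>\<nu>' (J y))"
        using integrable_bounded_translate[OF nJ(1,2) mf B(2)] fd[OF dd(1)] by (intro integral_mono) auto
      also have "\<dots> = G y + e / 8"
        using integrable_bounded_translate[OF nJ(1,2) mf B(2), where x = "x + y"]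
        by (simp add: G_def NJ.prob_space add.assoc)
      finally have "g (x + cs ! J y) + c' (J y) - e / 8 < G y + e / 8"
        using n'(4)[of "J y"] J(1) by simp
      moreover have "g (x + y) \<le> g (x + cs ! J y) + e / 8" by (rule gd[OF dd(2)])
      moreover have "0 \<le> 2 * B * indicator {y. R < norm y} y" using B by simp
      ultimately show ?thesis using e by linarith
    qed
    have i1: "integrable \<nu> (\<lambda>y. g (x + y))" by (rule integrable_bounded_translate[OF nd(1,2) mg gB])
    have i2: "integrable \<nu> (\<lambda>y. c' (J y))" by (rule integral_finite_index(1)[OF N.prob_space_axioms _ JN]) measurable
    have i3: "integrable \<nu> (\<lambda>y. 2 * B * indicator {y. R < norm y} y)"
      by (rule N.integrable_const_bound[of _ "2 * B"]) (use B in \<open>auto simp: indicator_def\<close>)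
    have i4: "integrable \<nu> G" by (rule N.integrable_const_bound[of _ B]) (use GB mG in auto)
    have "(\<integral>y. g (x + y) + c' (J y) - e / 2 - 2 * B * indicator {y. R < norm y} y \<partial>\<nu>) \<le> (\<integral>y. G y \<partial>\<nu>)"
      using i1 i2 i3 i4 G_ge by (intro integral_mono) auto
    also have "(\<integral>y. g (x + y) + c' (J y) - e / 2 - 2 * B * indicator {y. R < norm y} y \<partial>\<nu>)
        = (\<integral>y. g (x + y) \<partial>\<nu>) + (\<Sum>i\<le>N. ?w i * c' i) - e / 2 - 2 * B * measure \<nu> {y. R < norm y}"
      using i1 i2 i3 integral_finite_index(2)[where J = J and \<kappa> = c', OF N.prob_space_axioms _ JN] N.prob_space
      by (simp add: sp)
    finally show "(\<integral>y. g (x + y) \<partial>\<nu>) - c \<le> S (s + t) f x + e"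
      using main tail pint by linarith
  qed
  then show "S s (S t f) x \<le> S (s + t) f x + e" unfolding g_def .
qed

end

section \<open>The iterated operators\<close>

lemma dyadic_floor:
  fixes t :: real
  assumes "0 \<le> t"
  shows "real (nat \<lfloor>2 ^ n * t\<rfloor>) / 2 ^ n \<le> t" "t < real (nat \<lfloor>2 ^ n * t\<rfloor>) / 2 ^ n + 1 / 2 ^ n"
proof -
  have r: "real (nat \<lfloor>2 ^ n * t\<rfloor>) = of_int \<lfloor>2 ^ n * t\<rfloor>" using assms by simp
  have "of_int \<lfloor>2 ^ n * t\<rfloor> \<le> 2 ^ n * t" "2 ^ n * t < of_int \<lfloor>2 ^ n * t\<rfloor> + 1" by linarith+
  then show "real (nat \<lfloor>2 ^ n * t\<rfloor>) / 2 ^ n \<le> t" "t < real (nat \<lfloor>2 ^ n * t\<rfloor>) / 2 ^ n + 1 / 2 ^ n"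
    unfolding r by (simp_all add: field_simps)
qed

context wasserstein_perturbation
begin

lemma bounded_ucont_funpow_pert:
  assumes "0 \<le> s" "s \<le> 1" "bounded_ucont f"
  shows "bounded_ucont ((S s ^^ k) f)"
  by (induction k) (auto intro: assms bounded_ucont_pert)

lemma funpow_pert_mono:
  assumes "0 \<le> s" "s \<le> 1" "bounded_ucont f" "bounded_ucont g" "\<And>x. f x \<le> g x"
  shows "(S s ^^ k) f x \<le> (S s ^^ k) g x"
  by (induction k arbitrary: x) (auto intro: assms pert_mono bounded_ucont_funpow_pert)

lemma funpow_pert_halve:
  assumes s: "0 \<le> s" "s \<le> 1" and f: "bounded_ucont f"
  shows "(S (s / 2) ^^ (2 * k)) f x \<le> (S s ^^ k) f x"
proof (induction k arbitrary: x)
  case (Suc k)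
  let ?g = "(S (s / 2) ^^ (2 * k)) f"
  have g: "bounded_ucont ?g" "bounded_ucont ((S s ^^ k) f)"
    using s f by (auto intro!: bounded_ucont_funpow_pert)
  have "(S (s / 2) ^^ (2 * Suc k)) f x = S (s / 2) (S (s / 2) ?g) x" by simp
  also have "\<dots> \<le> S (s / 2 + s / 2) ?g x" by (intro pert_pert_le) (use s g in auto)
  also have "\<dots> = S s ?g x" by simp
  also have "\<dots> \<le> S s ((S s ^^ k) f) x" by (intro pert_mono s g Suc.IH)
  finally show ?case by simp
qed simp

text \<open>Refining the grid halves each full step. If \<open>t\<close> has reached the midpoint of
  its dyadic interval, then \<open>k'\<close> is odd and the remainder \<open>r\<close> is split
  into \<open>h / 2\<close> and \<open>r - h / 2\<close> as well. Both changes are instances of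
  \<open>pert_pert_le\<close>.\<close>

lemma pert_iter_Suc_le:
  assumes t: "0 \<le> t" "t \<le> 1" and f: "bounded_ucont f"
  shows "pert_iter p \<phi> \<mu> (Suc n) t f x \<le> pert_iter p \<phi> \<mu> n t f x"
proof -
  define h :: real where "h = 1 / 2 ^ n"
  define k where "k = nat \<lfloor>2 ^ n * t\<rfloor>"
  define k' where "k' = nat \<lfloor>2 ^ Suc n * t\<rfloor>"
  have h: "0 < h" "h \<le> 1" "1 / 2 ^ Suc n = h / 2" by (auto simp: h_def)
  have k: "real k * h \<le> t" "t < real k * h + h" using dyadic_floor[OF t(1), of n] by (auto simp: k_def h_def)
  have k': "real k' * (h / 2) \<le> t" "t < real k' * (h / 2) + h / 2"
    using dyadic_floor[OF t(1), of "Suc n"] by (auto simp: k'_def h_def)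
  have "real k' * (h / 2) < (2 * real k + 2) * (h / 2)" "2 * real k * (h / 2) < (real k' + 1) * (h / 2)"
    using k k' by (simp_all add: field_simps)
  then have "real k' < 2 * real k + 2" "2 * real k < real k' + 1"
    using h(1) by (auto simp only: mult_less_cancel_right_pos half_gt_zero)
  then have "k' = 2 * k \<or> k' = Suc (2 * k)" by linarith
  define r where "r = t - real k * h"
  have r: "0 \<le> r" "r \<le> 1" using k t h by (auto simp: r_def intro: order_trans[OF _ t(2)])
  have Sr: "bounded_ucont (S r f)" by (rule bounded_ucont_pert[OF r f])
  have iter: "pert_iter p \<phi> \<mu> n t f = (S h ^^ k) (S r f)"
    by (simp add: pert_iter_def Let_def h_def k_def r_def)
  have iter': "pert_iter p \<phi> \<mu> (Suc n) t f = (S (h / 2) ^^ k') (S (t - real k' * (h / 2)) f)"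
    by (simp add: pert_iter_def Let_def h_def k'_def mult.commute)
  from \<open>k' = 2 * k \<or> k' = Suc (2 * k)\<close> show ?thesis
  proof
    assume eq: "k' = 2 * k"
    then have "t - real k' * (h / 2) = r" by (simp add: r_def)
    then show ?thesis unfolding iter iter' using funpow_pert_halve[of h "S r f" k x] h Sr eq by simp
  next
    assume eq: "k' = Suc (2 * k)"
    then have rr: "t - real k' * (h / 2) = r - h / 2" by (simp add: r_def field_simps)
    then have r': "0 \<le> r - h / 2" using k'(1) by simp
    have Sr': "bounded_ucont (S (h / 2) (S (r - h / 2) f))"
      using h r r' f by (intro bounded_ucont_pert) auto
    have "(S (h / 2) ^^ k') (S (r - h / 2) f) x = (S (h / 2) ^^ (2 * k)) (S (h / 2) (S (r - h / 2) f)) x"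
      unfolding eq funpow_Suc_right by simp
    also have "\<dots> \<le> (S (h / 2) ^^ (2 * k)) (S r f) x"
    proof (rule funpow_pert_mono[OF _ _ Sr' Sr])
      show "S (h / 2) (S (r - h / 2) f) z \<le> S r f z" for z
        using pert_pert_le[of "h / 2" "r - h / 2" f z] h r r' f by simp
    qed (use h in auto)
    also have "\<dots> \<le> (S h ^^ k) (S r f) x" using h by (intro funpow_pert_halve Sr) auto
    finally show ?thesis unfolding iter iter' rr .
  qed
qed

lemma integral_mu_add:
  assumes st: "0 \<le> s" "0 \<le> t" "s + t \<le> 1" and f: "f \<in> borel_measurable borel" and B: "\<And>x. \<bar>f x\<bar> \<le> (B::real)"
  shows "integrable (\<mu> s) (\<lambda>y. \<integral>z. f (y + z) \<partial>\<mu> t)"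
    and "(\<integral>y. \<integral>z. f (y + z) \<partial>\<mu> t \<partial>\<mu> s) = (\<integral>y. f y \<partial>\<mu> (s + t))"
proof -
  have "s \<le> 1" "t \<le> 1" using st by auto
  note s = prob_momentD[OF mu_moment[OF st(1) this(1)]] and t = prob_momentD[OF mu_moment[OF st(2) this(2)]]
  interpret s: prob_space "\<mu> s" by (fact s)
  interpret t: prob_space "\<mu> t" by (fact t)
  interpret P: pair_prob_space "\<mu> s" "\<mu> t" by unfold_locales
  have add_meas: "(\<lambda>z. fst z + snd z) \<in> \<mu> s \<Otimes>\<^sub>M \<mu> t \<rightarrow>\<^sub>M borel"
    unfolding measurable_cong_sets[OF sets_pair_measure_cong[OF s(2) t(2)] refl] by measurable
  have int: "integrable (\<mu> s \<Otimes>\<^sub>M \<mu> t) (\<lambda>z. f (fst z + snd z))"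
  proof (rule P.integrable_const_bound[of _ B])
    show "(\<lambda>z. f (fst z + snd z)) \<in> borel_measurable (\<mu> s \<Otimes>\<^sub>M \<mu> t)"
      by (rule measurable_compose[OF add_meas f])
  qed (simp add: B)
  show "integrable (\<mu> s) (\<lambda>y. \<integral>z. f (y + z) \<partial>\<mu> t)"
    using P.integrable_fst'[OF int] by simp
  have "(\<integral>y. \<integral>z. f (y + z) \<partial>\<mu> t \<partial>\<mu> s) = (\<integral>z. f (fst z + snd z) \<partial>(\<mu> s \<Otimes>\<^sub>M \<mu> t))"
    using P.integral_fst'[OF int] by simp
  also have "\<dots> = (\<integral>y. f y \<partial>\<mu> (s + t))"
    unfolding mu_add[OF st, symmetric] by (rule integral_distr[OF add_meas f, symmetric])
  finally show "(\<integral>y. \<integral>z. f (y + z) \<partial>\<mu> t \<partial>\<mu> s) = (\<integral>y. f y \<partial>\<mu> (s + t))" .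
qed

text \<open>Translating \<open>\<mu>\<^sub>t\<close> by \<open>t b\<close> gives a competitor at distance at most \<open>t |b|\<close> from \<open>\<mu>\<^sub>t\<close>, at cost
  \<open>t \<phi>(|b|)\<close>. Such competitors are stable under iteration.\<close>

lemma pert_ge_shift:
  assumes t: "0 \<le> t" "t \<le> 1" and f: "bounded_ucont f" and b: "\<phi> (norm b) \<le> ereal c"
  shows "levy_semigroup \<mu> t f (x + t *\<^sub>R b) - t * c \<le> S t f x"
proof -
  obtain B where B: "\<And>x. \<bar>f x\<bar> \<le> B" by (metis f bounded_ucontE)
  note mt = mu_moment[OF t]
  note d = prob_momentD[OF mt]
  note [measurable_cong] = d(2)
  interpret prob_space "\<mu> t" by (fact d)
  have p1: "1 \<le> p" using p_gt_1 by simp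
  define T where "T y = y + t *\<^sub>R b" for y
  have T[measurable]: "T \<in> borel_measurable borel" unfolding T_def by measurable
  let ?\<gamma> = "distr (\<mu> t) (borel \<Otimes>\<^sub>M borel) (\<lambda>y. (y, T y))"
  have g: "?\<gamma> \<in> couplings (\<mu> t) (distr (\<mu> t) borel T)" by (rule distr_coupling[OF d(1,2) T])
  have cost: "(\<integral>z. norm (snd z - fst z) powr p \<partial>?\<gamma>) = (t * norm b) powr p"
    unfolding integral_distr_coupling[OF d(2) T] using t by (simp add: T_def prob_space)
  have "integrable ?\<gamma> (\<lambda>z. norm (snd z - fst z) powr p)"
    by (subst integrable_distr_eq) (auto simp: T_def)
  then have nm: "distr (\<mu> t) borel T \<in> prob_moment p" by (rule coupling_snd_moment[OF p1 mt g])
  have W: "W (\<mu> t) (distr (\<mu> t) borel T) \<le> t * norm b"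
    using t cost by (intro wasserstein_le[OF p1 g]) auto
  have c0: "0 \<le> c" using order_trans[OF phi_nonneg b] by simp
  have "perspective \<phi> t (W (\<mu> t) (distr (\<mu> t) borel T)) \<le> perspective \<phi> t (t * norm b)"
    by (rule perspective_mono[OF t(1) wasserstein_nonneg[OF mt nm] W])
  also have "\<dots> \<le> ereal (t * c)"
    using t b c0 by (cases "t = 0") (auto simp: perspective_le_iff perspective_zero)
  finally have "(\<integral>y. f (x + y) \<partial>distr (\<mu> t) borel T) - t * c \<le> S t f x"
    by (intro pert_ge[OF t B nm])
  also have "(\<integral>y. f (x + y) \<partial>distr (\<mu> t) borel T) = levy_semigroup \<mu> t f (x + t *\<^sub>R b)"
    unfolding levy_semigroup_def
    using bounded_ucont_measurable[OF f] by (subst integral_distr) (auto simp: T_def algebra_simps)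
  finally show ?thesis .
qed

text \<open>The drift \<open>b\<close> is deterministic and the same in each step, so it commutes
  with convolution: translations and costs add up linearly in time, and the laws combine by
  \<open>integral_mu_add\<close>.\<close>

lemma funpow_pert_ge_shift:
  assumes s: "0 \<le> s" "s \<le> 1" and r: "0 \<le> r" and f: "bounded_ucont f" and b: "\<phi> (norm b) \<le> ereal c"
    and "real k * s + r \<le> 1"
  shows "levy_semigroup \<mu> (real k * s + r) f (x + (real k * s + r) *\<^sub>R b) - (real k * s + r) * c
    \<le> (S s ^^ k) (S r f) x"
  using assms(6)
proof (induction k arbitrary: x)
  case 0
  then show ?case using pert_ge_shift[OF r _ f b] by simp
next
  case (Suc k)
  obtain B where B: "\<And>x. \<bar>f x\<bar> \<le> B" by (metis f bounded_ucontE)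
  note mf[measurable] = bounded_ucont_measurable[OF f]
  define \<tau> where "\<tau> = real k * s + r"
  have \<tau>: "0 \<le> \<tau>" "s + \<tau> \<le> 1" "\<tau> \<le> 1" "r \<le> 1"
  proof -
    have k: "0 \<le> real k * s" using s by simp
    then show "0 \<le> \<tau>" using r by (simp add: \<tau>_def)
    have "real k * s + s + r \<le> 1" using Suc.prems by (simp add: algebra_simps)
    with k s r show "s + \<tau> \<le> 1" "\<tau> \<le> 1" "r \<le> 1" unfolding \<tau>_def by linarith+
  qed
  have eq: "real (Suc k) * s + r = s + \<tau>" by (simp add: \<tau>_def algebra_simps)
  define g where "g = (S s ^^ k) (S r f)"
  have g: "bounded_ucont g"
    unfolding g_def by (intro bounded_ucont_funpow_pert bounded_ucont_pert s r f \<tau>)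
  obtain B' where B': "\<And>x. \<bar>g x\<bar> \<le> B'" by (metis g bounded_ucontE)
  note ms = prob_momentD[OF mu_moment[OF s]]
  interpret prob_space "\<mu> s" by (fact ms)
  define f' where "f' y = f (x + (s + \<tau>) *\<^sub>R b + y)" for y
  have f': "f' \<in> borel_measurable borel" "\<And>y. \<bar>f' y\<bar> \<le> B" unfolding f'_def using B by auto
  note add = integral_mu_add[OF s(1) \<tau>(1,2) f']
  have "levy_semigroup \<mu> (s + \<tau>) f (x + (s + \<tau>) *\<^sub>R b) - \<tau> * c = (\<integral>y. (\<integral>z. f' (y + z) \<partial>\<mu> \<tau>) - \<tau> * c \<partial>\<mu> s)"
    using add by (simp add: levy_semigroup_def f'_def prob_space)
  also have "\<dots> \<le> (\<integral>y. g (x + s *\<^sub>R b + y) \<partial>\<mu> s)"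
  proof (rule integral_mono)
    show "integrable (\<mu> s) (\<lambda>y. (\<integral>z. f' (y + z) \<partial>\<mu> \<tau>) - \<tau> * c)" using add by simp
    show "integrable (\<mu> s) (\<lambda>y. g (x + s *\<^sub>R b + y))"
      by (rule integrable_bounded_translate[OF ms(1,2) bounded_ucont_measurable[OF g] B'])
    fix y
    show "(\<integral>z. f' (y + z) \<partial>\<mu> \<tau>) - \<tau> * c \<le> g (x + s *\<^sub>R b + y)"
      using Suc.IH[of "x + s *\<^sub>R b + y", folded \<tau>_def g_def, OF \<tau>(3)]
      by (simp add: f'_def levy_semigroup_def algebra_simps)
  qed
  also have "\<dots> = levy_semigroup \<mu> s g (x + s *\<^sub>R b)" by (simp add: levy_semigroup_def)
  finally have "levy_semigroup \<mu> (s + \<tau>) f (x + (s + \<tau>) *\<^sub>R b) - \<tau> * c - s * c \<le> S s g x"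
    using pert_ge_shift[OF s g b, of x] by linarith
  then show ?case unfolding eq by (simp add: g_def algebra_simps)
qed

lemma pert_iter_ge_shift:
  assumes t: "0 \<le> t" "t \<le> 1" and f: "bounded_ucont f" and b: "\<phi> (norm b) \<le> ereal c"
  shows "levy_semigroup \<mu> t f (x + t *\<^sub>R b) - t * c \<le> pert_iter p \<phi> \<mu> n t f x"
  using funpow_pert_ge_shift[of "1 / 2 ^ n" "t - real (nat \<lfloor>2 ^ n * t\<rfloor>) / 2 ^ n" f b c "nat \<lfloor>2 ^ n * t\<rfloor>" x]
    t f b dyadic_floor[OF t(1), of n]
  by (simp add: pert_iter_def Let_def)

text \<open>The decreasing iterates are bounded below by the Levy semigroup, which is the case
  \<open>b = 0\<close> of the translation bound.\<close>

lemma pert_iter_tendsto: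
  assumes t: "0 \<le> t" "t \<le> 1" and f: "bounded_ucont f"
  shows "(\<lambda>n. pert_iter p \<phi> \<mu> n t f x) \<longlonglongrightarrow> pert_semigroup p \<phi> \<mu> t f x"
proof -
  have "decseq (\<lambda>n. pert_iter p \<phi> \<mu> n t f x)"
    by (rule decseq_SucI) (rule pert_iter_Suc_le[OF t f])
  moreover have "levy_semigroup \<mu> t f x \<le> pert_iter p \<phi> \<mu> n t f x" for n
    using pert_iter_ge_shift[OF t f, of 0 0 x n] by (simp add: phi_zero)
  ultimately have "convergent (\<lambda>n. pert_iter p \<phi> \<mu> n t f x)"
    by (metis decseq_convergent convergentI)
  then show ?thesis unfolding pert_semigroup_def by (simp add: convergent_LIMSEQ_iff)
qed

lemma pert_semigroup_ge_shift:
  assumes t: "0 \<le> t" "t \<le> 1" and f: "bounded_ucont f" and b: "\<phi> (norm b) \<le> ereal c"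
  shows "levy_semigroup \<mu> t f (x + t *\<^sub>R b) - t * c \<le> pert_semigroup p \<phi> \<mu> t f x"
  by (rule LIMSEQ_le_const[OF pert_iter_tendsto[OF t f]]) (use pert_iter_ge_shift[OF t f b] in blast)

lemma pert_semigroup_le_pert:
  assumes t: "0 \<le> t" "t < 1" and f: "bounded_ucont f"
  shows "pert_semigroup p \<phi> \<mu> t f x \<le> S t f x"
proof -
  have t1: "t \<le> 1" using t by simp
  have "decseq (\<lambda>n. pert_iter p \<phi> \<mu> n t f x)"
    by (rule decseq_SucI) (rule pert_iter_Suc_le[OF t(1) t1 f])
  from decseq_ge[OF this pert_iter_tendsto[OF t(1) t1 f], of 0]
  have "pert_semigroup p \<phi> \<mu> t f x \<le> pert_iter p \<phi> \<mu> 0 t f x" .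
  \<comment> \<open>For \<open>t < 1\<close> the iterate of level 0 has no full step and is
    \<open>S t f\<close> itself.\<close>
  moreover have "\<lfloor>t\<rfloor> = 0" using t by linarith
  ultimately show ?thesis by (simp add: pert_iter_def)
qed

end

section \<open>Short-time asymptotics\<close>

lemma grad_eq: "GDERIV f x :> D \<Longrightarrow> grad f x = D"
  unfolding grad_def gderiv_def
proof (rule the_equality)
  fix D' assume d: "(f has_derivative (\<lambda>h. inner h D)) (at x)" "(f has_derivative (\<lambda>h. inner h D')) (at x)"
  have "(\<lambda>h. inner h D') = (\<lambda>h. inner h D)" by (rule has_derivative_unique[OF d(2,1)])
  then have "inner (D' - D) D' = inner (D' - D) D" by metis
  then have "inner (D' - D) (D' - D) = 0" by (simp add: inner_diff_right)
  then show "D' = D" by simp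
qed

lemma C01_has_derivative:
  assumes "f \<in> C01"
  shows "(f has_derivative (\<lambda>h. inner h (grad f x))) (at x)"
proof -
  obtain D where D: "GDERIV f x :> D" using assms unfolding C01_def by blast
  then show ?thesis unfolding grad_eq[OF D] by (simp add: gderiv_def)
qed

lemma C01_bounded_ucont: "f \<in> C01 \<Longrightarrow> bounded_ucont f"
  unfolding C01_def by (auto intro: bounded_ucont_C0)

lemma C01_grad_bounded:
  assumes "f \<in> C01"
  obtains L where "0 \<le> L" "\<And>x. norm (grad f x) \<le> L"
proof -
  have "bounded (range (grad f))"
    using assms unfolding C01_def by (intro bounded_range_vanishing_at_infinity) auto
  then obtain L where L: "\<And>x. norm (grad f x) \<le> L" unfolding bounded_iff by auto
  then have "0 \<le> L" using norm_ge_zero order_trans by blast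
  with L that show ?thesis by blast
qed

lemma onorm_inner_le:
  fixes D :: "'a::euclidean_space"
  assumes "norm D \<le> L"
  shows "onorm (\<lambda>h. inner h D) \<le> L"
proof (rule onorm_le)
  fix h
  have "\<bar>inner h D\<bar> \<le> norm h * norm D" by (rule Cauchy_Schwarz_ineq2)
  also have "\<dots> \<le> norm h * L" using assms by (intro mult_left_mono) auto
  finally show "norm (inner h D) \<le> L * norm h" by (simp add: mult.commute)
qed

lemma C01_lipschitz:
  assumes f: "f \<in> C01" and L: "\<And>x. norm (grad f x) \<le> L"
  shows "\<bar>f z - f y\<bar> \<le> L * norm (z - y)"
proof -
  have "norm (f z - f y) \<le> L * norm (z - y)"
  proof (rule differentiable_bound[OF convex_UNIV])
    fix x
    show "(f has_derivative (\<lambda>h. inner h (grad f x))) (at x within UNIV)" using C01_has_derivative[OF f] by simp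
    show "onorm (\<lambda>h. inner h (grad f x)) \<le> L"
      using L by (rule onorm_inner_le)
  qed auto
  then show ?thesis by simp
qed

text \<open>Mean value inequality for \<open>f\<close> minus its linear part at \<open>x\<close>, on
  a ball where the gradient varies by less than \<open>\<delta>\<close>. Neither endpoint has to be
  \<open>x\<close>: a coupling moves mass from \<open>x + y\<close> to \<open>x + z\<close>, while
  the limit involves the gradient at \<open>x\<close>.\<close>

lemma C01_taylor:
  fixes f :: "'a::euclidean_space \<Rightarrow> real"
  assumes f: "f \<in> C01" and d: "0 < \<delta>"
  obtains \<rho> where "0 < \<rho>"
    "\<And>x y z. norm y \<le> \<rho> \<Longrightarrow> norm z \<le> \<rho> \<Longrightarrow> \<bar>f (x + z) - f (x + y) - inner (z - y) (grad f x)\<bar> \<le> \<delta> * norm (z - y)"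
proof -
  have "uniformly_continuous_on UNIV (grad f)"
    using f unfolding C01_def by (intro uniformly_continuous_vanishing_at_infinity) auto
  then obtain r where r: "0 < r" "\<And>x x'. dist x' x < r \<Longrightarrow> dist (grad f x') (grad f x) < \<delta>"
    unfolding uniformly_continuous_on_def using d by (metis UNIV_I)
  have "\<bar>f (x + z) - f (x + y) - inner (z - y) (grad f x)\<bar> \<le> \<delta> * norm (z - y)"
    if yz: "norm y \<le> r / 2" "norm z \<le> r / 2" for x y z
  proof -
    define h where "h v = f v - inner v (grad f x)" for v
    have "norm (h (x + z) - h (x + y)) \<le> \<delta> * norm (x + z - (x + y))"
    proof (rule differentiable_bound[OF convex_cball[of x "r / 2"]])
      fix v assume v: "v \<in> cball x (r / 2)"
      have "(h has_derivative (\<lambda>k. inner k (grad f v) - inner k (grad f x))) (at v)"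
        unfolding h_def by (intro derivative_intros C01_has_derivative f bounded_linear_imp_has_derivative bounded_linear_inner_left)
      then show "(h has_derivative (\<lambda>k. inner k (grad f v - grad f x))) (at v within cball x (r / 2))"
        by (simp add: inner_diff_right has_derivative_at_withinI)
      have "dist v x < r" using v r(1) by (auto simp: dist_commute)
      then have "norm (grad f v - grad f x) \<le> \<delta>" using r(2) by (simp add: dist_norm less_imp_le)
      then show "onorm (\<lambda>k. inner k (grad f v - grad f x)) \<le> \<delta>"
        by (rule onorm_inner_le)
    qed (use yz in \<open>auto simp: dist_norm\<close>)
    then show ?thesis by (simp add: h_def inner_diff_left inner_add_left algebra_simps)
  qed
  with r(1) show ?thesis by (intro that[of "r / 2"]) auto
qed

text \<open>Three regimes. If start and displacement are small, the slope \<open>A\<close> applies.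
  If the start lies outside the ball of radius \<open>\<rho> / 2\<close>, the displacement is cut at
  \<open>K * w\<close>: the part below is paid by the small probability of such starts, the part
  above by \<open>1 / K powr (p - 1)\<close>. A large displacement is dominated by its
  \<open>p\<close>-th power, which yields the term in \<open>w powr p\<close>.\<close>

lemma coupling_increment_le:
  fixes f :: "'a::euclidean_space \<Rightarrow> real" and \<mu> \<nu> :: "'a measure"
  assumes p: "1 < p" and m: "\<mu> \<in> prob_moment p" "\<nu> \<in> prob_moment p" and g: "\<gamma> \<in> couplings \<mu> \<nu>"
    and cost: "(\<integral>z. norm (snd z - fst z) powr p \<partial>\<gamma>) \<le> w powr p" and w: "0 < w"
    and f: "f \<in> borel_measurable borel" "\<And>x. \<bar>f x\<bar> \<le> B"
    and lip: "\<And>y z. f z - f y \<le> L * norm (z - y)" and L: "0 \<le> L"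
    and loc: "\<And>y z. norm y \<le> \<rho> \<Longrightarrow> norm z \<le> \<rho> \<Longrightarrow> f z - f y \<le> A * norm (z - y)" and A: "0 \<le> A"
    and \<rho>: "0 < \<rho>" and K: "0 < K"
  shows "(\<integral>y. f y \<partial>\<nu>) \<le> (\<integral>y. f y \<partial>\<mu>)
    + (A + L * (K * measure \<mu> {y. \<rho> / 2 < norm y} + 1 / K powr (p - 1))) * w
    + L / (\<rho> / 2) powr (p - 1) * w powr p"
proof -
  note c = couplingsD[OF g]
  note d = prob_momentD[OF m(1)] and d' = prob_momentD[OF m(2)]
  interpret prob_space \<gamma> by (fact c)
  have p1: "1 \<le> p" using p by simp
  define u where "u z = norm (snd z - fst z)" for z :: "'a \<times> 'a"
  let ?P = "{y. \<rho> / 2 < norm y} :: 'a set"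
  have [measurable]: "?P \<in> sets borel" by measurable
  \<comment> \<open>A majorant with one nonnegative summand per regime. Being affine in
    \<open>u z powr p\<close> and in an indicator of the first coordinate, it is integrated using
    the cost and the first marginal alone.\<close>
  define H where "H z = A * ((1 - 1 / p) * w + w / p * (u z powr p / w powr p))
    + L * (K * w * indicator ?P (fst z) + u z powr p / (K * w) powr (p - 1))
    + L * (u z powr p / (\<rho> / 2) powr (p - 1))" for z
  have cu: "integrable \<gamma> (\<lambda>z. u z powr p)" unfolding u_def by (rule coupling_cost_integrable[OF p1 m g])
  have ci: "integrable \<gamma> (\<lambda>z. indicator ?P (fst z) :: real)"
    "(\<integral>z. indicator ?P (fst z) \<partial>\<gamma>) = measure \<mu> ?P"
  proof -
    have sp: "space \<mu> = UNIV" using sets_eq_imp_space_eq[OF d(2)] by simp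
    interpret m: prob_space \<mu> by (fact d)
    have "integrable \<mu> (indicator ?P :: 'a \<Rightarrow> real)"
      by (rule integrable_real_indicator) (auto simp: d(2) m.emeasure_eq_measure)
    then show "integrable \<gamma> (\<lambda>z. indicator ?P (fst z) :: real)"
      by (subst integral_coupling_fst(2)[OF g]) auto
    show "(\<integral>z. indicator ?P (fst z) \<partial>\<gamma>) = measure \<mu> ?P"
      by (subst integral_coupling_fst(1)[OF g]) (auto simp: sp)
  qed
  have fi: "integrable \<gamma> (\<lambda>z. f (fst z))" "integrable \<gamma> (\<lambda>z. f (snd z))"
    using integral_coupling_fst(2)[OF g f(1)] integral_coupling_snd(2)[OF g f(1)]
      integrable_bounded_translate[OF d(1,2) f, where x = 0] integrable_bounded_translate[OF d'(1,2) f, where x = 0] by auto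
  have H_ge: "f (snd z) - f (fst z) \<le> H z" for z
  proof -
    have u0: "0 \<le> u z" by (simp add: u_def)
    have n: "0 \<le> A * ((1 - 1 / p) * w + w / p * (u z powr p / w powr p))"
      "0 \<le> L * (K * w * indicator ?P (fst z) + u z powr p / (K * w) powr (p - 1))"
      "0 \<le> L * (u z powr p / (\<rho> / 2) powr (p - 1))"
      using A L w K p by (auto intro!: mult_nonneg_nonneg add_nonneg_nonneg)
    consider "norm (fst z) \<le> \<rho> / 2" "u z \<le> \<rho> / 2" | "\<rho> / 2 < norm (fst z)" | "\<rho> / 2 \<le> u z" by linarith
    then show ?thesis
    proof cases
      case 1
      have "norm (snd z) \<le> norm (fst z) + u z" unfolding u_def by (metis norm_triangle_sub)
      then have "f (snd z) - f (fst z) \<le> A * u z" using 1 \<rho> unfolding u_def by (intro loc) auto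
      also have "\<dots> \<le> A * ((1 - 1 / p) * w + w / p * (u z powr p / w powr p))"
        by (intro mult_left_mono le_powr_tangent p u0 w A)
      finally show ?thesis using n unfolding H_def by linarith
    next
      case 2
      have "u z \<le> K * w * indicator ?P (fst z) + u z powr p / (K * w) powr (p - 1)"
      proof (cases "u z \<le> K * w")
        case True
        then show ?thesis using 2 by (auto intro: order_trans)
      next
        case False
        then have "u z \<le> u z powr p / (K * w) powr (p - 1)" using K w by (intro tail_le_powr p1) auto
        then show ?thesis using K w 2 by (auto intro: order_trans)
      qed
      then have "L * u z \<le> L * (K * w * indicator ?P (fst z) + u z powr p / (K * w) powr (p - 1))"
        using L by (rule mult_left_mono)
      moreover have "f (snd z) - f (fst z) \<le> L * u z" unfolding u_def by (rule lip)
      ultimately show ?thesis using n unfolding H_def by linarith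
    next
      case 3
      then have "L * u z \<le> L * (u z powr p / (\<rho> / 2) powr (p - 1))"
        using \<rho> by (intro mult_left_mono tail_le_powr p1 L) auto
      moreover have "f (snd z) - f (fst z) \<le> L * u z" unfolding u_def by (rule lip)
      ultimately show ?thesis using n unfolding H_def by linarith
    qed
  qed
  let ?I = "\<integral>z. u z powr p \<partial>\<gamma>"
  have "(\<integral>y. f y \<partial>\<nu>) - (\<integral>y. f y \<partial>\<mu>) = (\<integral>z. f (snd z) - f (fst z) \<partial>\<gamma>)"
    using fi integral_coupling_fst(1)[OF g f(1)] integral_coupling_snd(1)[OF g f(1)] by simp
  also have "\<dots> \<le> (\<integral>z. H z \<partial>\<gamma>)"
    using fi cu ci(1) H_ge unfolding H_def by (intro integral_mono) auto
  also have "\<dots> = A * ((1 - 1 / p) * w + w / p * (?I / w powr p))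
    + L * (K * w * measure \<mu> ?P + ?I / (K * w) powr (p - 1)) + L * (?I / (\<rho> / 2) powr (p - 1))"
    using cu ci prob_space unfolding H_def by simp
  also have "\<dots> \<le> A * ((1 - 1 / p) * w + w / p * (w powr p / w powr p))
    + L * (K * w * measure \<mu> ?P + w powr p / (K * w) powr (p - 1)) + L * (w powr p / (\<rho> / 2) powr (p - 1))"
    using cost A L w p unfolding u_def
    by (intro add_mono mult_left_mono divide_right_mono order_refl) auto
  also have "(1 - 1 / p) * w + w / p * (w powr p / w powr p) = w"
    using w p by (simp add: field_simps)
  also have "w powr p / (K * w) powr (p - 1) = 1 / K powr (p - 1) * w"
    using w K powr_mult_base[of w "p - 1"] by (simp add: powr_mult field_simps)
  finally show ?thesis by (simp add: algebra_simps)
qed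

section \<open>Growth of the penalty, its conjugate, and the two first-order bounds\<close>

context wasserstein_perturbation
begin

definition phistar :: "real \<Rightarrow> real" where
  "phistar y = real_of_ereal (conjugate_fun \<phi> y)"

text \<open>By convexity of \<open>x \<mapsto> \<phi> (x powr (1 / p))\<close> and
  \<open>\<phi> 0 = 0\<close>, one has \<open>\<phi> x \<le> (x / a) powr p * \<phi> a\<close> for
  \<open>0 < x \<le> a\<close>. One point of positive value thus forces growth of order
  \<open>a powr p\<close>; subtracting \<open>k\<close> covers the range below that point.\<close>

lemma phi_growth:
  obtains c k where "0 < c" "0 \<le> k" "\<And>a. 0 \<le> a \<Longrightarrow> ereal (c * a powr p - k) \<le> \<phi> a"
proof -
  obtain x where x: "0 \<le> x" "0 < \<phi> x" using phi_nonzero by blast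
  have x0: "0 < x" using x phi_zero by (cases "x = 0") auto
  \<comment> \<open>A finite positive lower bound for \<open>\<phi> x\<close>; it is 1 if
    \<open>\<phi> x\<close> is \<open>\<infinity>\<close>.\<close>
  obtain k :: real where k: "0 < k" "ereal k \<le> \<phi> x"
    using x(2) by (cases "\<phi> x") (auto intro: that[of 1])
  have "ereal (k / x powr p * a powr p - k) \<le> \<phi> a" if a: "0 \<le> a" for a
  proof (cases "a \<le> x")
    case True
    then have "k / x powr p * a powr p \<le> k / x powr p * x powr p"
      using a k p_gt_1 by (intro mult_left_mono powr_mono2) auto
    then have "ereal (k / x powr p * a powr p - k) \<le> 0" using x0 by simp
    also have "0 \<le> \<phi> a" using a by (rule phi_nonneg)
    finally show ?thesis .
  next
    case False
    then have xa: "x < a" by simp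
    then have a0: "0 < a" using x0 by simp
    have r: "x powr p < a powr p" using xa x0 p_gt_1 by (intro powr_less_mono2) auto
    have "ereal (k / x powr p * a powr p) \<le> \<phi> a"
    proof (cases "\<phi> a")
      case (real q)
      let ?u = "x powr p / a powr p"
      have u: "0 \<le> ?u" "?u \<le> 1" using r a0 by auto
      have "\<phi> ((?u * a powr p + (1 - ?u) * 0) powr (1 / p)) \<le> ereal (?u * q + (1 - ?u) * 0)"
        by (rule convex_epigraph_add[OF phi_powr_convex])
           (use u a0 real p_gt_1 phi_zero in \<open>auto simp: powr_powr\<close>)
      also have "(?u * a powr p + (1 - ?u) * 0) powr (1 / p) = x"
        using a0 x0 p_gt_1 by (simp add: powr_powr)
      finally have "ereal k \<le> ereal (?u * q + (1 - ?u) * 0)" by (rule order_trans[OF k(2)])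
      then have "k \<le> ?u * q" by simp
      then have "k / x powr p * a powr p \<le> (?u * q) / x powr p * a powr p"
        by (intro mult_right_mono divide_right_mono) auto
      also have "\<dots> = q" using x0 a0 by simp
      finally show ?thesis using real by simp
    qed (use phi_nonneg[OF a] in auto)
    then show ?thesis by (rule order_trans[rotated]) (use k in auto)
  qed
  then show ?thesis using k x0 by (intro that[of "k / x powr p" k]) auto
qed

text \<open>Half of the growth absorbs the linear term, the constant \<open>k\<close> and the margin
  1; the other half remains as \<open>C\<close>. The margin keeps near-maximisers of the conjugate
  below \<open>R\<close>, and \<open>C\<close> absorbs the term in \<open>w powr p\<close> of the
  increment estimate.\<close>

lemma phi_superlinear:
  assumes L: "0 \<le> L"
  obtains R C where "1 \<le> R" "0 < C" "\<And>a. R \<le> a \<Longrightarrow> ereal (a * L + C * a powr p + 1) \<le> \<phi> a"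
proof -
  obtain c k where c: "0 < c" "0 \<le> k" and gr: "\<And>a. 0 \<le> a \<Longrightarrow> ereal (c * a powr p - k) \<le> \<phi> a"
    using phi_growth by metis
  \<comment> \<open>\<open>Q \<le> a powr (p - 1)\<close> means
    \<open>L + k + 1 \<le> c / 2 * a powr (p - 1)\<close>.\<close>
  define Q where "Q = 2 * (L + k + 1) / c"
  have Q: "0 < Q" using c L by (simp add: Q_def)
  define R where "R = max 1 (Q powr (1 / (p - 1)))"
  have "ereal (a * L + c / 2 * a powr p + 1) \<le> \<phi> a" if a: "R \<le> a" for a
  proof -
    have a1: "1 \<le> a" "Q powr (1 / (p - 1)) \<le> a" using a by (auto simp: R_def)
    have "(Q powr (1 / (p - 1))) powr (p - 1) \<le> a powr (p - 1)"
      using a1 p_gt_1 by (intro powr_mono2) auto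
    then have "Q \<le> a powr (p - 1)" using Q p_gt_1 by (simp add: powr_powr)
    then have "c / 2 * (a * Q) \<le> c / 2 * (a * a powr (p - 1))"
      using a1 c by (intro mult_left_mono) auto
    also have "a * a powr (p - 1) = a powr p" using a1 powr_mult_base[of a "p - 1"] by simp
    also have "c / 2 * (a * Q) = a * L + a * (k + 1)" using c by (simp add: Q_def field_simps)
    finally have "a * L + a * (k + 1) \<le> c / 2 * a powr p" .
    moreover have "k + 1 \<le> a * (k + 1)" using mult_right_mono[of 1 a "k + 1"] a1 c by simp
    moreover have "c * a powr p = c / 2 * a powr p + c / 2 * a powr p" by simp
    ultimately have "a * L + c / 2 * a powr p + 1 \<le> c * a powr p - k" by linarith
    then have "ereal (a * L + c / 2 * a powr p + 1) \<le> ereal (c * a powr p - k)" by simp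
    also have "\<dots> \<le> \<phi> a" using a1 by (intro gr) simp
    finally show ?thesis .
  qed
  then show ?thesis using c by (intro that[of R "c / 2"]) (auto simp: R_def)
qed

lemma ereal_phistar:
  assumes y: "0 \<le> y"
  shows "ereal (phistar y) = conjugate_fun \<phi> y"
proof -
  obtain R C where R: "1 \<le> R" "0 < C" "\<And>a. R \<le> a \<Longrightarrow> ereal (a * y + C * a powr p + 1) \<le> \<phi> a"
    using phi_superlinear[OF y] by metis
  have "conjugate_fun \<phi> y \<le> ereal (R * y)"
    unfolding conjugate_fun_def
  proof (rule SUP_least)
    fix a :: real assume "a \<in> {0..}"
    then have a: "0 \<le> a" by simp
    show "ereal (a * y) - \<phi> a \<le> ereal (R * y)"
    proof (cases "R \<le> a")
      case True
      have "0 \<le> C * a powr p" "0 \<le> R * y" using R y by auto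
      with R(3)[OF True] show ?thesis by (cases "\<phi> a") auto
    next
      case False
      then have "a * y \<le> R * y" using y by (intro mult_right_mono) auto
      with phi_nonneg[OF a] show ?thesis by (cases "\<phi> a") auto
    qed
  qed
  moreover have "0 \<le> conjugate_fun \<phi> y"
    unfolding conjugate_fun_def by (rule SUP_upper2[of 0]) (auto simp: phi_zero)
  ultimately have "\<bar>conjugate_fun \<phi> y\<bar> \<noteq> \<infinity>" by auto
  then show ?thesis unfolding phistar_def by (simp add: ereal_real')
qed

lemma phistar_ge:
  assumes "0 \<le> y" "0 \<le> a" "\<phi> a \<le> ereal q"
  shows "a * y - q \<le> phistar y"
proof -
  have "ereal (a * y - q) \<le> ereal (a * y) - \<phi> a"
    using assms(3) phi_nonneg[OF assms(2)] by (cases "\<phi> a") auto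
  also have "\<dots> \<le> ereal (phistar y)"
    unfolding ereal_phistar[OF assms(1)] conjugate_fun_def using assms(2) by (intro SUP_upper) simp
  finally show ?thesis by simp
qed

lemma phistar_nonneg: "0 \<le> y \<Longrightarrow> 0 \<le> phistar y"
  using phistar_ge[of y 0 0] by (simp add: phi_zero)

text \<open>Beyond \<open>R\<close> the value \<open>a * y - \<phi> a\<close> is at most -1 while
  \<open>phistar y\<close> is nonnegative, so near-maximisers with error up to 1 stay bounded. One
  \<open>R\<close> serves all slopes up to \<open>L\<close>, hence all gradients of
  \<open>f\<close>.\<close>

lemma phistar_approx:
  assumes L: "0 \<le> L"
  obtains R where "1 \<le> R"
    "\<forall>y\<in>{0..L}. \<forall>e\<in>{0<..1}. \<exists>a q. 0 \<le> a \<and> a \<le> R \<and> \<phi> a = ereal q \<and> phistar y - e < a * y - q"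
proof -
  obtain R C where R: "1 \<le> R" "0 < C" "\<And>a. R \<le> a \<Longrightarrow> ereal (a * L + C * a powr p + 1) \<le> \<phi> a"
    using phi_superlinear[OF L] by metis
  have "\<exists>a q. 0 \<le> a \<and> a \<le> R \<and> \<phi> a = ereal q \<and> phistar y - e < a * y - q"
    if y: "0 \<le> y" "y \<le> L" and e: "0 < e" "e \<le> 1" for y e
  proof -
    have "ereal (phistar y - e) < ereal (phistar y)" using e by simp
    then have "ereal (phistar y - e) < (SUP x\<in>{0..}. ereal (x * y) - \<phi> x)"
      unfolding ereal_phistar[OF y(1)] conjugate_fun_def .
    then obtain a where a: "0 \<le> a" and l: "ereal (phistar y - e) < ereal (a * y) - \<phi> a"
      unfolding less_SUP_iff by auto
    then obtain q where q: "\<phi> a = ereal q" using phi_nonneg[OF a] by (cases "\<phi> a") auto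
    have l': "phistar y - e < a * y - q" using l q by simp
    have "a \<le> R"
    proof (rule ccontr)
      assume "\<not> a \<le> R"
      then have "a * L + C * a powr p + 1 \<le> q" using R(3)[of a] q by simp
      moreover have "a * y \<le> a * L" using a y by (intro mult_left_mono) auto
      moreover have "0 \<le> C * a powr p" using R by simp
      ultimately show False using l' phistar_nonneg[OF y(1)] e by linarith
    qed
    with a q l' show ?thesis by blast
  qed
  then show ?thesis using R(1) by (intro that[of R]) auto
qed

text \<open>With \<open>a = W (\<mu> t) \<nu> / t\<close>, the gain divided by \<open>t\<close> is
  at most \<open>a * A + D * t powr (p - 1) * a powr p - \<phi> a\<close>. For
  \<open>R \<le> a\<close> the growth of \<open>\<phi>\<close> makes this negative. For
  \<open>a < R\<close> the errors are small because \<open>a\<close> is bounded, and the rest is at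
  most \<open>phistar G\<close>.\<close>

lemma pert_le_levy:
  assumes f: "f \<in> C01" and e: "0 < e"
  shows "\<forall>\<^sub>F t in at_right 0. \<forall>x. S t f x \<le> levy_semigroup \<mu> t f x + t * (phistar (norm (grad f x)) + e)"
proof -
  obtain B where B: "\<And>x. \<bar>f x\<bar> \<le> B" by (metis C01_bounded_ucont[OF f] bounded_ucontE)
  note mf = bounded_ucont_measurable[OF C01_bounded_ucont[OF f]]
  obtain L where L: "0 \<le> L" "\<And>x. norm (grad f x) \<le> L" using C01_grad_bounded[OF f] by metis
  have p1: "1 \<le> p" using p_gt_1 by simp
  \<comment> \<open>\<open>L + 1\<close> leaves room for the slope \<open>A\<close>, which exceeds
    the norm of the gradient by at most \<open>3 * \<delta> \<le> 1\<close>.\<close>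
  obtain R C where R: "1 \<le> R" "0 < C" "\<And>a. R \<le> a \<Longrightarrow> ereal (a * (L + 1) + C * a powr p + 1) \<le> \<phi> a"
    using phi_superlinear[of "L + 1"] L(1) by auto
  \<comment> \<open>Three errors \<open>\<delta>\<close> enter the slope: the Taylor expansion,
    starts outside the small ball, and displacements above the cut.\<close>
  define \<delta> where "\<delta> = min 1 (e / (2 * R)) / 3"
  have \<delta>: "0 < \<delta>" "3 * \<delta> \<le> 1" "R * (3 * \<delta>) \<le> e / 2"
  proof -
    show "0 < \<delta>" "3 * \<delta> \<le> 1" using e R by (auto simp: \<delta>_def)
    have "R * (3 * \<delta>) \<le> R * (e / (2 * R))" using R(1) by (intro mult_left_mono) (auto simp: \<delta>_def)
    also have "\<dots> = e / 2" using R(1) by simp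
    finally show "R * (3 * \<delta>) \<le> e / 2" .
  qed
  obtain \<rho> where \<rho>: "0 < \<rho>" and taylor: "\<And>x y z. norm y \<le> \<rho> \<Longrightarrow> norm z \<le> \<rho> \<Longrightarrow>
      \<bar>f (x + z) - f (x + y) - inner (z - y) (grad f x)\<bar> \<le> \<delta> * norm (z - y)"
    using C01_taylor[OF f \<delta>(1)] by metis
  \<comment> \<open>Makes \<open>L / K powr (p - 1)\<close> at most \<open>\<delta>\<close>. Since
    \<open>K\<close> does not depend on \<open>t\<close>, the term \<open>L * K * ?P t\<close> still
    tends to 0.\<close>
  define K where "K = ((L + 1) / \<delta>) powr (1 / (p - 1))"
  have K: "0 < K" using L \<delta> by (simp add: K_def)
  have "K powr (p - 1) = (L + 1) / \<delta>" using L \<delta> p_gt_1 by (simp add: K_def powr_powr)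
  then have "L * (1 / K powr (p - 1)) = \<delta> * (L / (L + 1))" by simp
  also have "\<dots> \<le> \<delta> * 1" using L(1) \<delta>(1) by (intro mult_left_mono) auto
  finally have LK: "L * (1 / K powr (p - 1)) \<le> \<delta>" by simp
  define D where "D = L / (\<rho> / 2) powr (p - 1)"
  have D: "0 \<le> D" using L by (simp add: D_def)
  let ?P = "\<lambda>t. measure (\<mu> t) {y. \<rho> / 2 < norm y}"
  have "((\<lambda>t. L * K * ?P t) \<longlongrightarrow> L * K * 0) (at_right 0)"
    using \<rho> by (intro tendsto_mult tendsto_const mu_vanish) auto
  then have ev1: "\<forall>\<^sub>F t in at_right 0. L * K * ?P t < \<delta>" using \<delta>(1) by (intro order_tendstoD) auto
  have pw0: "((\<lambda>t :: real. t powr (p - 1)) \<longlongrightarrow> 0) (at_right 0)"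
    using p_gt_1 by (intro tendsto_zero_powrI[where b = "p - 1"] tendsto_const)
      (auto intro: tendsto_ident_at eventually_at_rightI[of 0 1])
  have "((\<lambda>t. D * t powr (p - 1)) \<longlongrightarrow> D * 0) (at_right 0)" by (intro tendsto_mult tendsto_const pw0)
  then have ev2: "\<forall>\<^sub>F t in at_right 0. D * t powr (p - 1) < min C (e / (2 * R powr p))"
    using R e by (intro order_tendstoD) auto
  have ev3: "\<forall>\<^sub>F t :: real in at_right 0. 0 < t \<and> t < 1" by (auto intro: eventually_at_rightI[of 0 1])
  from ev1 ev2 ev3 show ?thesis
  proof eventually_elim
    case (elim t)
    then have t: "0 \<le> t" "t \<le> 1" "0 < t" by auto
    note mt = mu_moment[OF t(1,2)]
    show ?case
    proof
      fix x
      define G where "G = norm (grad f x)"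
      have G: "0 \<le> G" "G \<le> L" using L by (auto simp: G_def)
      define A where "A = G + \<delta> + L * (K * ?P t + 1 / K powr (p - 1))"
      have A: "A \<le> G + 3 * \<delta>" "0 \<le> A"
      proof -
        have "L * (K * ?P t + 1 / K powr (p - 1)) = L * K * ?P t + L * (1 / K powr (p - 1))" by (simp add: algebra_simps)
        then show "A \<le> G + 3 * \<delta>" using elim(1) LK unfolding A_def by linarith
        show "0 \<le> A" unfolding A_def using G \<delta> L K by (intro add_nonneg_nonneg mult_nonneg_nonneg) auto
      qed
      show "S t f x \<le> levy_semigroup \<mu> t f x + t * (phistar (norm (grad f x)) + e)"
        unfolding G_def[symmetric]
      proof (rule pert_le[where B = B, OF t(1,2) B])
        fix \<nu> c assume n: "\<nu> \<in> prob_moment p" "0 \<le> c" "perspective \<phi> t (W (\<mu> t) \<nu>) = ereal c"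
        let ?W = "W (\<mu> t) \<nu>"
        have W0: "0 \<le> ?W" by (rule wasserstein_nonneg[OF mt n(1)])
        have step: "(\<integral>y. f (x + y) \<partial>\<nu>) \<le> levy_semigroup \<mu> t f x + A * w + D * w powr p" if w: "?W < w" for w
        proof -
          obtain \<gamma> where g: "\<gamma> \<in> couplings (\<mu> t) \<nu>" "(\<integral>z. norm (snd z - fst z) powr p \<partial>\<gamma>) < w powr p"
            using wasserstein_less_coupling[OF p1 mt n(1) w] .
          show ?thesis
            unfolding levy_semigroup_def A_def D_def
          proof (rule coupling_increment_le[where B = B, OF p_gt_1 mt n(1) g(1)])
            show "f (x + z) - f (x + y) \<le> L * norm (z - y)" for y z
              using C01_lipschitz[OF f L(2), of "x + z" "x + y"] by simp
            show "f (x + z) - f (x + y) \<le> (G + \<delta>) * norm (z - y)" if "norm y \<le> \<rho>" "norm z \<le> \<rho>" for y z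
            proof -
              have "inner (z - y) (grad f x) \<le> norm (z - y) * G" unfolding G_def by (rule norm_cauchy_schwarz)
              with taylor[OF that, of x] show ?thesis by (simp add: algebra_simps)
            qed
          qed (use g W0 w mf B L G \<delta> \<rho> K in auto)
        qed
        \<comment> \<open>Near-optimal couplings belong to some \<open>w\<close> above
          \<open>?W\<close>, and the increment estimate asks for positive \<open>w\<close>;
          continuity in \<open>w\<close> recovers the value at \<open>?W\<close>, including
          \<open>?W = 0\<close>.\<close>
        have "(\<integral>y. f (x + y) \<partial>\<nu>) \<le> levy_semigroup \<mu> t f x + A * ?W + D * ?W powr p"
        proof (rule tendsto_lowerbound)
          have ev0: "\<forall>\<^sub>F w in at_right ?W. 0 \<le> w"
            using W0 by (intro eventually_at_rightI[of ?W "?W + 1"]) auto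
          show "((\<lambda>w. levy_semigroup \<mu> t f x + A * w + D * w powr p)
              \<longlongrightarrow> levy_semigroup \<mu> t f x + A * ?W + D * ?W powr p) (at_right ?W)"
            using p_gt_1 ev0 by (intro tendsto_intros tendsto_powr' disjI2 conjI) auto
          show "\<forall>\<^sub>F w in at_right ?W. (\<integral>y. f (x + y) \<partial>\<nu>) \<le> levy_semigroup \<mu> t f x + A * w + D * w powr p"
            using step by (intro eventually_at_rightI[of ?W "?W + 1"]) auto
        qed simp
        moreover
        define a where "a = ?W / t"
        define q where "q = c / t"
        have a: "0 \<le> a" "?W = t * a" using W0 t by (auto simp: a_def)
        have q: "\<phi> a = ereal q" "c = t * q"
        proof -
          have "ereal t * \<phi> a = ereal c" using n(3) t by (simp add: perspective_def a_def)
          then show "\<phi> a = ereal q" using t by (cases "\<phi> a") (auto simp: q_def)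
          show "c = t * q" using t by (simp add: q_def)
        qed
        \<comment> \<open>The scaling by \<open>t\<close> turns the superlinear term into
          \<open>t\<close> times a quantity that vanishes with \<open>t\<close> for bounded
          \<open>a\<close>.\<close>
        have "D * ?W powr p = t * (D * t powr (p - 1) * a powr p)"
          using t a powr_mult_base[of t "p - 1"] by (simp add: powr_mult algebra_simps)
        moreover have "a * A + D * t powr (p - 1) * a powr p - q \<le> phistar G + e"
        proof (cases "R \<le> a")
          case True
          have "a * (L + 1) + C * a powr p + 1 \<le> q" using R(3)[OF True] q by simp
          moreover have "a * A \<le> a * (L + 1)" using a A G \<delta> by (intro mult_left_mono) auto
          moreover have "D * t powr (p - 1) * a powr p \<le> C * a powr p" using elim(2) by (intro mult_right_mono) auto
          ultimately show ?thesis using phistar_nonneg[OF G(1)] e by linarith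
        next
          case False
          have "a * A \<le> a * (G + 3 * \<delta>)" using a A by (intro mult_left_mono) auto
          also have "\<dots> \<le> a * G + R * (3 * \<delta>)" using False a \<delta> by (simp add: distrib_left mult_right_mono)
          finally have "a * A \<le> a * G + e / 2" using \<delta> by linarith
          moreover have "D * t powr (p - 1) * a powr p \<le> e / (2 * R powr p) * R powr p"
            using elim(2) False a D p_gt_1 R e by (intro mult_mono powr_mono2) auto
          moreover have "e / (2 * R powr p) * R powr p = e / 2" using R by simp
          moreover have "a * G - q \<le> phistar G" using q by (intro phistar_ge G a) simp
          ultimately show ?thesis by linarith
        qed
        then have "t * (a * A + D * t powr (p - 1) * a powr p - q) \<le> t * (phistar G + e)"
          using t by (intro mult_left_mono) auto
        moreover have "t * (a * A + D * t powr (p - 1) * a powr p - q) = A * ?W + t * (D * t powr (p - 1) * a powr p) - c"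
          using a q by (simp add: algebra_simps)
        ultimately show "(\<integral>y. f (x + y) \<partial>\<nu>) - c \<le> levy_semigroup \<mu> t f x + t * (phistar G + e)"
          by linarith
      qed
    qed
  qed
qed

text \<open>The Levy semigroup is evaluated at the moved point \<open>x + t *\<^sub>R b\<close>.
  Uniform convergence to \<open>g\<close> on the whole space allows this, and uniform continuity of
  \<open>g\<close> returns to \<open>x\<close>.\<close>

lemma pert_semigroup_ge:
  assumes f: "f \<in> C01" and gen: "has_generator_value \<mu> f g" and e: "0 < e"
  shows "\<forall>\<^sub>F t in at_right 0. \<forall>x. f x + t * (g x + phistar (norm (grad f x)) - e) \<le> pert_semigroup p \<phi> \<mu> t f x"
proof -
  \<comment> \<open>Four errors share \<open>e\<close>: near-maximality in the conjugate, the Taylor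
    expansion, the continuity of \<open>g\<close>, and the convergence to \<open>g\<close>. The cap
    1 is the range of errors in \<open>phistar_approx\<close>.\<close>
  define e' where "e' = min 1 (e / 4)"
  have e': "0 < e'" "e' \<le> 1" "4 * e' \<le> e" using e by (auto simp: e'_def)
  note fb = C01_bounded_ucont[OF f]
  obtain L where L: "0 \<le> L" "\<And>x. norm (grad f x) \<le> L" using C01_grad_bounded[OF f] by metis
  obtain R where R: "1 \<le> R" "\<forall>y\<in>{0..L}. \<forall>e\<in>{0<..1}.
      \<exists>a q. 0 \<le> a \<and> a \<le> R \<and> \<phi> a = ereal q \<and> phistar y - e < a * y - q"
    using phistar_approx[OF L(1)] .
  have "0 < e' / R" using e' R by simp
  from C01_taylor[OF f this] obtain \<rho> where \<rho>: "0 < \<rho>" and taylor: "\<And>x y z. norm y \<le> \<rho> \<Longrightarrow> norm z \<le> \<rho> \<Longrightarrow>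
      \<bar>f (x + z) - f (x + y) - inner (z - y) (grad f x)\<bar> \<le> e' / R * norm (z - y)" by metis
  have "bounded_ucont g" using gen by (auto simp: has_generator_value_def intro: bounded_ucont_C0)
  then obtain r where r: "0 < r" "\<And>x x'. dist x' x < r \<Longrightarrow> dist (g x') (g x) < e'"
    unfolding bounded_ucont_def uniformly_continuous_on_def using e'(1) by (metis UNIV_I)
  have "\<forall>\<^sub>F t in at_right 0. \<forall>x\<in>UNIV. dist ((levy_semigroup \<mu> t f x - f x) / t) (g x) < e'"
    by (rule uniform_limitD) (use gen e' in \<open>auto simp: has_generator_value_def\<close>)
  moreover have "\<forall>\<^sub>F t in at_right 0. 0 < t \<and> t < min 1 (min r \<rho> / R)"
    using r \<rho> R by (intro eventually_at_rightI[of 0 "min 1 (min r \<rho> / R)"]) auto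
  ultimately show ?thesis
  proof eventually_elim
    case (elim t)
    then have t: "0 \<le> t" "t \<le> 1" "0 < t" by auto
    have "t < min r \<rho> / R" using elim(2) by simp
    then have "t * R < min r \<rho>" using R(1) by (simp add: pos_less_divide_eq)
    then have tR: "t * R < r" "t * R < \<rho>" by simp_all
    have levy: "f z + t * (g z - e') \<le> levy_semigroup \<mu> t f z" for z
    proof -
      have "g z - e' < (levy_semigroup \<mu> t f z - f z) / t"
        using bspec[OF elim(1) UNIV_I, of z] unfolding dist_real_def by linarith
      then show ?thesis using t by (simp add: field_simps)
    qed
    show ?case
    proof
      fix x
      define G where "G = norm (grad f x)"
      have "G \<in> {0..L}" "e' \<in> {0<..1}" using L e' by (simp_all add: G_def)
      then obtain a q where a: "0 \<le> a" "a \<le> R" and q: "\<phi> a = ereal q" and l: "phistar G - e' < a * G - q"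
        using R(2) by blast
      \<comment> \<open>A vector of length \<open>a\<close> along the gradient, or 0 where the
        gradient vanishes. Hence only \<open>norm b \<le> a\<close> holds in general, and
        monotonicity of \<open>\<phi>\<close> bounds the cost.\<close>
      define b where "b = a *\<^sub>R sgn (grad f x)"
      have nb: "norm b \<le> a" using a by (simp add: b_def norm_sgn)
      have "\<phi> (norm b) \<le> \<phi> a" using nb a by (intro mono_onD[OF phi_mono]) auto
      then have phib: "\<phi> (norm b) \<le> ereal q" using q by simp
      have bG: "inner b (grad f x) = a * G"
        by (cases "grad f x = 0")
           (simp_all add: b_def sgn_div_norm G_def power2_norm_eq_inner[symmetric] power2_eq_square)
      have tb: "norm (t *\<^sub>R b) \<le> t * R" using t nb a by (simp add: mult_left_mono)
      have "\<bar>f (x + t *\<^sub>R b) - f x - t * (a * G)\<bar> \<le> e' / R * norm (t *\<^sub>R b)"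
        using taylor[of 0 "t *\<^sub>R b" x] tb tR \<rho> bG by simp
      also have "\<dots> \<le> e' / R * (t * R)" using tb e' R by (intro mult_left_mono) auto
      also have "\<dots> = t * e'" using R by simp
      finally have f_ge: "f x + t * (a * G) - t * e' \<le> f (x + t *\<^sub>R b)" by linarith
      have "dist (x + t *\<^sub>R b) x < r" using tb tR by (simp add: dist_norm)
      from r(2)[OF this] have "g x - e' \<le> g (x + t *\<^sub>R b)" unfolding dist_real_def by linarith
      then have "t * (g x - e' - e') \<le> t * (g (x + t *\<^sub>R b) - e')" using t by (intro mult_left_mono) auto
      with levy[of "x + t *\<^sub>R b"] f_ge
      have "f x + t * (a * G) - t * e' + t * (g x - e' - e') - t * q \<le> levy_semigroup \<mu> t f (x + t *\<^sub>R b) - t * q"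
        by linarith
      also have "\<dots> \<le> pert_semigroup p \<phi> \<mu> t f x" by (rule pert_semigroup_ge_shift[OF t(1,2) fb phib])
      finally have "f x + t * (g x + (a * G - q) - 3 * e') \<le> pert_semigroup p \<phi> \<mu> t f x" by (simp add: algebra_simps)
      moreover have "t * (g x + phistar G - e) \<le> t * (g x + (a * G - q) - 3 * e')"
        using l e' t by (intro mult_left_mono) linarith+
      ultimately show "f x + t * (g x + phistar (norm (grad f x)) - e) \<le> pert_semigroup p \<phi> \<mu> t f x"
        unfolding G_def[symmetric] by linarith
    qed
  qed
qed

text \<open>The upper bound is relative to \<open>levy_semigroup\<close>; its convergence to
  \<open>g\<close> costs a further \<open>e / 4\<close>. The lower bound already contains
  \<open>g\<close>.\<close>

lemma pert_semigroup_generator: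
  assumes f: "f \<in> C01" and gen: "has_generator_value \<mu> f g"
  shows "uniform_limit UNIV (\<lambda>t x. (pert_semigroup p \<phi> \<mu> t f x - f x) / t)
    (\<lambda>x. g x + phistar (norm (grad f x))) (at_right 0)"
proof (rule uniform_limitI)
  fix e :: real assume e: "0 < e"
  have "\<forall>\<^sub>F t in at_right 0. \<forall>x. S t f x \<le> levy_semigroup \<mu> t f x + t * (phistar (norm (grad f x)) + e / 4)"
    using e by (intro pert_le_levy f) auto
  moreover have "\<forall>\<^sub>F t in at_right 0. \<forall>x. f x + t * (g x + phistar (norm (grad f x)) - e / 2) \<le> pert_semigroup p \<phi> \<mu> t f x"
    using e by (intro pert_semigroup_ge f gen) auto
  moreover have "\<forall>\<^sub>F t in at_right 0. \<forall>x\<in>UNIV. dist ((levy_semigroup \<mu> t f x - f x) / t) (g x) < e / 4"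
    by (rule uniform_limitD) (use gen e in \<open>auto simp: has_generator_value_def\<close>)
  moreover have "\<forall>\<^sub>F t :: real in at_right 0. 0 < t \<and> t < 1" by (auto intro: eventually_at_rightI[of 0 1])
  ultimately show "\<forall>\<^sub>F t in at_right 0. \<forall>x\<in>UNIV.
      dist ((pert_semigroup p \<phi> \<mu> t f x - f x) / t) (g x + phistar (norm (grad f x))) < e"
  proof eventually_elim
    case (elim t)
    show ?case
    proof
      fix x
      define Q where "Q = phistar (norm (grad f x))"
      have t: "0 < t" using elim by simp
      have "(levy_semigroup \<mu> t f x - f x) / t < g x + e / 4"
        using bspec[OF elim(3) UNIV_I, of x] unfolding dist_real_def by linarith
      then have "levy_semigroup \<mu> t f x - f x < t * (g x + e / 4)"
        using t by (simp add: pos_divide_less_eq mult.commute)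
      moreover have "pert_semigroup p \<phi> \<mu> t f x \<le> S t f x"
        using elim(4) by (intro pert_semigroup_le_pert C01_bounded_ucont f) auto
      moreover have "S t f x \<le> levy_semigroup \<mu> t f x + t * (Q + e / 4)" using elim(1) by (simp add: Q_def)
      ultimately have "pert_semigroup p \<phi> \<mu> t f x - f x \<le> t * (g x + e / 4) + t * (Q + e / 4)" by linarith
      also have "\<dots> = t * (g x + Q + e / 2)" by (simp add: algebra_simps)
      finally have "(pert_semigroup p \<phi> \<mu> t f x - f x) / t \<le> g x + Q + e / 2"
        using t by (simp add: pos_divide_le_eq mult.commute)
      moreover have "t * (g x + Q - e / 2) \<le> pert_semigroup p \<phi> \<mu> t f x - f x"
        using elim(2)[rule_format, of x] unfolding Q_def[symmetric] by linarith
      then have "g x + Q - e / 2 \<le> (pert_semigroup p \<phi> \<mu> t f x - f x) / t"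
        using t by (simp add: pos_le_divide_eq mult.commute)
      ultimately show "dist ((pert_semigroup p \<phi> \<mu> t f x - f x) / t) (g x + phistar (norm (grad f x))) < e"
        unfolding Q_def[symmetric] dist_real_def using e by linarith
    qed
  qed
qed

end

section \<open>Marginal laws of a Levy process\<close>

context levy_process
begin

lemma random_variable_increment:
  "0 \<le> s \<Longrightarrow> 0 \<le> t \<Longrightarrow> random_variable borel (\<lambda>\<omega>. X t \<omega> - X s \<omega>)"
  using random_variable_X[of s] random_variable_X[of t] by simp

lemma marginal_zero: "distr M borel (X 0) = return borel 0"
proof -
  have "distr M borel (X 0) = distr M borel (\<lambda>\<omega>. 0)"
    by (rule distr_cong_AE) (use starts_at_0 random_variable_X[of 0] in auto)
  also have "\<dots> = return borel 0"
    by (rule measure_eqI) (auto simp: emeasure_distr indicator_def emeasure_space_1)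
  finally show ?thesis .
qed

text \<open>Increments over the grid \<open>0, s, s + t\<close>. The first one,
  \<open>X s - X 0\<close>, equals \<open>X s\<close> only almost surely, so independence is
  transferred through the joint law.\<close>

lemma indep_increments:
  assumes s: "0 < s" and t: "0 < t"
  shows "indep_var borel (X s) borel (\<lambda>\<omega>. X (s + t) \<omega> - X s \<omega>)"
proof -
  define \<tau> where "\<tau> i = (if i = 0 then 0 else if i = Suc 0 then s else s + t)" for i :: nat
  have mono: "strict_mono_on {..2} \<tau>"
    using s t by (auto simp: strict_mono_on_def \<tau>_def)
  have ind: "indep_vars (\<lambda>_. borel) (\<lambda>i \<omega>. X (\<tau> (Suc i)) \<omega> - X (\<tau> i) \<omega>) {..<2}"
    by (rule independent_increments[OF _ mono]) (simp add: \<tau>_def)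
  have "indep_var borel (\<lambda>\<omega>. X (\<tau> (Suc 0)) \<omega> - X (\<tau> 0) \<omega>) borel (\<lambda>\<omega>. X (\<tau> (Suc 1)) \<omega> - X (\<tau> 1) \<omega>)"
    using indep_var_compose[OF indep_var_restrict[OF ind, of "{0}" "{1}"],
        of "\<lambda>g. g 0" borel "\<lambda>g. g 1" borel]
    by (simp add: comp_def measurable_component_singleton)
  then have "indep_var borel (\<lambda>\<omega>. X s \<omega> - X 0 \<omega>) borel (\<lambda>\<omega>. X (s + t) \<omega> - X s \<omega>)"
    by (simp add: \<tau>_def)
  moreover have X0: "AE \<omega> in M. X s \<omega> - X 0 \<omega> = X s \<omega>" using starts_at_0 by eventually_elim simp
  have rv[measurable]: "random_variable borel (X s)" "random_variable borel (\<lambda>\<omega>. X s \<omega> - X 0 \<omega>)"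
    "random_variable borel (\<lambda>\<omega>. X (s + t) \<omega> - X s \<omega>)"
    using s t by (auto intro!: random_variable_X random_variable_increment simp del: borel_measurable_diff)
  have "distr M borel (\<lambda>\<omega>. X s \<omega> - X 0 \<omega>) = distr M borel (X s)"
    by (rule distr_cong_AE[OF refl refl X0 rv(2,1)])
  moreover have "distr M (borel \<Otimes>\<^sub>M borel) (\<lambda>\<omega>. (X s \<omega> - X 0 \<omega>, X (s + t) \<omega> - X s \<omega>))
      = distr M (borel \<Otimes>\<^sub>M borel) (\<lambda>\<omega>. (X s \<omega>, X (s + t) \<omega> - X s \<omega>))"
    by (rule distr_cong_AE[OF refl refl]) (use X0 in \<open>auto intro!: measurable_Pair rv\<close>)
  ultimately show ?thesis
    using rv by (simp add: indep_var_distribution_eq)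
qed

text \<open>For positive times, \<open>X (s + t)\<close> is \<open>X s\<close> plus an independent
  increment with the law of \<open>X t\<close>. The grid of increments must be strictly increasing,
  so time 0 is treated separately, by the Dirac measure as neutral element of convolution.\<close>

lemma marginal_add:
  assumes st: "0 \<le> s" "0 \<le> t"
  shows "distr (distr M borel (X s) \<Otimes>\<^sub>M distr M borel (X t)) borel (\<lambda>z. fst z + snd z) = distr M borel (X (s + t))"
proof -
  have rv: "random_variable borel (X s)" "random_variable borel (X t)" "random_variable borel (X (s + t))"
    using st by (auto intro: random_variable_X)
  have pair_return: "distr (return borel 0 \<Otimes>\<^sub>M \<nu>) borel (\<lambda>z. fst z + snd z) = \<nu>"
    "distr (\<nu> \<Otimes>\<^sub>M return borel 0) borel (\<lambda>z. fst z + snd z) = \<nu>"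
    if n: "prob_space \<nu>" "sets \<nu> = sets borel" for \<nu> :: "'a measure"
  proof -
    interpret n: prob_space \<nu> by (fact n)
    interpret r: prob_space "return borel (0::'a)" by (rule prob_space_return) simp
    have sp: "space \<nu> = UNIV" using sets_eq_imp_space_eq[OF n(2)] by simp
    have plus: "(\<lambda>z. fst z + snd z) \<in> borel \<Otimes>\<^sub>M borel \<rightarrow>\<^sub>M (borel :: 'a measure)" by measurable
    have m: "(\<lambda>z. fst z + snd z) \<in> return borel 0 \<Otimes>\<^sub>M \<nu> \<rightarrow>\<^sub>M borel" "(\<lambda>z. fst z + snd z) \<in> \<nu> \<Otimes>\<^sub>M return borel 0 \<rightarrow>\<^sub>M borel"
      using plus n(2) by (auto cong: measurable_cong_sets sets_pair_measure_cong)
    show "distr (return borel 0 \<Otimes>\<^sub>M \<nu>) borel (\<lambda>z. fst z + snd z) = \<nu>"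
    proof (rule measure_eqI)
      fix A assume "A \<in> sets (distr (return borel 0 \<Otimes>\<^sub>M \<nu>) borel (\<lambda>z. fst z + snd z))"
      then have A: "A \<in> sets borel" by simp
      have "emeasure (distr (return borel 0 \<Otimes>\<^sub>M \<nu>) borel (\<lambda>z. fst z + snd z)) A
          = (\<integral>\<^sup>+z. indicator A (fst z + snd z) \<partial>(return borel 0 \<Otimes>\<^sub>M \<nu>))"
        using A m by (subst nn_integral_indicator[symmetric], simp, subst nn_integral_distr) auto
      also have "\<dots> = (\<integral>\<^sup>+x. \<integral>\<^sup>+y. indicator A (x + y) \<partial>\<nu> \<partial>return borel 0)"
        using A m by (subst n.nn_integral_fst[symmetric]) (auto intro!: measurable_compose[OF m(1)])
      also have "\<dots> = (\<integral>\<^sup>+y. indicator A y \<partial>\<nu>)"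
      proof (subst nn_integral_return)
        have "(\<lambda>z. indicator A (fst z + snd z) :: ennreal) \<in> borel_measurable (return borel 0 \<Otimes>\<^sub>M \<nu>)"
          using A by (intro measurable_compose[OF m(1)]) simp
        from n.borel_measurable_nn_integral_fst[OF this]
        show "(\<lambda>x. \<integral>\<^sup>+y. indicator A (x + y) \<partial>\<nu>) \<in> borel_measurable borel" by simp
      qed auto
      also have "\<dots> = emeasure \<nu> A" using A n(2) by simp
      finally show "emeasure (distr (return borel 0 \<Otimes>\<^sub>M \<nu>) borel (\<lambda>z. fst z + snd z)) A = emeasure \<nu> A" .
    qed (simp add: n)
    show "distr (\<nu> \<Otimes>\<^sub>M return borel 0) borel (\<lambda>z. fst z + snd z) = \<nu>"
    proof (rule measure_eqI)
      fix A assume "A \<in> sets (distr (\<nu> \<Otimes>\<^sub>M return borel 0) borel (\<lambda>z. fst z + snd z))"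
      then have A: "A \<in> sets borel" by simp
      have "emeasure (distr (\<nu> \<Otimes>\<^sub>M return borel 0) borel (\<lambda>z. fst z + snd z)) A
          = (\<integral>\<^sup>+z. indicator A (fst z + snd z) \<partial>(\<nu> \<Otimes>\<^sub>M return borel 0))"
        using A m by (subst nn_integral_indicator[symmetric], simp, subst nn_integral_distr) auto
      also have "\<dots> = (\<integral>\<^sup>+x. \<integral>\<^sup>+y. indicator A (x + y) \<partial>return borel 0 \<partial>\<nu>)"
        using A m by (subst r.nn_integral_fst[symmetric]) (auto intro!: measurable_compose[OF m(2)])
      also have "\<dots> = (\<integral>\<^sup>+y. indicator A y \<partial>\<nu>)"
        using A by (intro nn_integral_cong) (subst nn_integral_return; simp)
      also have "\<dots> = emeasure \<nu> A" using A n(2) by simp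
      finally show "emeasure (distr (\<nu> \<Otimes>\<^sub>M return borel 0) borel (\<lambda>z. fst z + snd z)) A = emeasure \<nu> A" .
    qed (simp add: n)
  qed
  consider "s = 0" | "t = 0" | "0 < s" "0 < t" using st by fastforce
  then show ?thesis
  proof cases
    case 1
    then show ?thesis using pair_return(1)[of "distr M borel (X t)"] rv
      by (simp add: marginal_zero prob_space_distr)
  next
    case 2
    then show ?thesis using pair_return(2)[of "distr M borel (X s)"] rv
      by (simp add: marginal_zero prob_space_distr)
  next
    case 3
    let ?Y = "\<lambda>\<omega>. X (s + t) \<omega> - X s \<omega>"
    have Y: "random_variable borel ?Y" using st by (intro random_variable_increment) auto
    have "distr M borel (X s) \<Otimes>\<^sub>M distr M borel (X t) = distr M borel (X s) \<Otimes>\<^sub>M distr M borel ?Y"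
      using stationary_increments[OF st] by simp
    also have "\<dots> = distr M (borel \<Otimes>\<^sub>M borel) (\<lambda>\<omega>. (X s \<omega>, ?Y \<omega>))"
      using indep_increments[OF 3] by (simp add: indep_var_distribution_eq)
    finally have "distr (distr M borel (X s) \<Otimes>\<^sub>M distr M borel (X t)) borel (\<lambda>z. fst z + snd z)
        = distr M borel (\<lambda>\<omega>. X s \<omega> + ?Y \<omega>)"
      using rv Y by (simp add: distr_distr comp_def)
    then show ?thesis by simp
  qed
qed

text \<open>If \<open>X\<^sub>1 = X\<^sub>t + (X\<^sub>1 - X\<^sub>t)\<close> has a finite moment, then by Fubini so does \<open>X\<^sub>t + y\<close> for some
  fixed \<open>y\<close>.\<close>

lemma marginal_moment:
  assumes p: "1 \<le> p" and t: "0 \<le> t" "t \<le> 1"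
    and int: "integrable (distr M borel (X 1)) (\<lambda>x. norm x powr p)"
  shows "distr M borel (X t) \<in> prob_moment p"
proof -
  let ?\<mu> = "\<lambda>t. distr M borel (X t)"
  have rv: "random_variable borel (X t)" "random_variable borel (X (1 - t))"
    using t by (auto intro!: random_variable_X)
  interpret a: prob_space "?\<mu> t" using rv by (intro prob_space_distr)
  interpret b: prob_space "?\<mu> (1 - t)" using rv by (intro prob_space_distr)
  interpret P: pair_prob_space "?\<mu> (1 - t)" "?\<mu> t" by unfold_locales
  have add_meas: "(\<lambda>z. fst z + snd z) \<in> ?\<mu> (1 - t) \<Otimes>\<^sub>M ?\<mu> t \<rightarrow>\<^sub>M borel"
  proof -
    have "sets (?\<mu> (1 - t) \<Otimes>\<^sub>M ?\<mu> t) = sets (borel \<Otimes>\<^sub>M borel)" by (rule sets_pair_measure_cong) auto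
    from measurable_cong_sets[OF this refl] show ?thesis by (rule ssubst) measurable
  qed
  have "integrable (distr (?\<mu> (1 - t) \<Otimes>\<^sub>M ?\<mu> t) borel (\<lambda>z. fst z + snd z)) (\<lambda>x. norm x powr p)"
    using marginal_add[of "1 - t" t] t int by simp
  then have "integrable (?\<mu> (1 - t) \<Otimes>\<^sub>M ?\<mu> t) (\<lambda>z. norm (fst z + snd z) powr p)"
    by (subst (asm) integrable_distr_eq) (auto simp: add_meas)
  from P.AE_integrable_fst'[OF this]
  have "AE y in ?\<mu> (1 - t). integrable (?\<mu> t) (\<lambda>x. norm (y + x) powr p)" by simp
  \<comment> \<open>An almost sure property under a probability measure holds at some point.\<close>
  then obtain y where y: "integrable (?\<mu> t) (\<lambda>x. norm (y + x) powr p)"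
    using b.AE_False b.ae_filter_bot by (metis (no_types, lifting) AE_E3 eventually_mono not_eventuallyD trivial_limit_def)
  have "integrable (?\<mu> t) (\<lambda>x. norm x powr p)"
  proof (rule Bochner_Integration.integrable_bound)
    show "integrable (?\<mu> t) (\<lambda>x. 2 powr p * (1/2 * norm (y + x) powr p + 1/2 * norm y powr p))"
      using y by auto
    show "AE x in ?\<mu> t. norm (norm x powr p) \<le> norm (2 powr p * (1/2 * norm (y + x) powr p + 1/2 * norm y powr p))"
    proof (rule AE_I2)
      fix x
      have "norm x powr p \<le> (norm (y + x) + norm y) powr p"
        using p norm_triangle_ineq4[of "y + x" y] by (intro powr_mono2) auto
      also have "\<dots> \<le> 2 powr p * (1/2 * norm (y + x) powr p + 1/2 * norm y powr p)"
        using powr_convex_combination[of p "norm (y + x)" "norm y" 1 1] p by simp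
      finally show "norm (norm x powr p) \<le> norm (2 powr p * (1/2 * norm (y + x) powr p + 1/2 * norm y powr p))" by simp
    qed
  qed simp
  then show ?thesis unfolding prob_moment_def using a.prob_space_axioms by simp
qed

text \<open>Stochastic continuity at time 0, read on the laws. As \<open>X 0\<close> vanishes only
  almost surely, the two events agree up to a null set.\<close>

lemma marginal_vanish:
  assumes e: "0 < e"
  shows "((\<lambda>t. measure (distr M borel (X t)) {x. e < norm x}) \<longlongrightarrow> 0) (at_right 0)"
proof -
  have "((\<lambda>s. prob {\<omega> \<in> space M. e < norm (X s \<omega> - X 0 \<omega>)}) \<longlongrightarrow> 0) (at_right 0)"
    by (rule tendsto_within_subset[OF stochastically_continuous]) (use e in auto)
  then show ?thesis
  proof (rule Lim_transform_eventually)
    have "measure (distr M borel (X s)) {x. e < norm x} = prob {\<omega> \<in> space M. e < norm (X s \<omega> - X 0 \<omega>)}"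
      if s: "0 < s" for s
    proof -
      have rv[measurable]: "random_variable borel (X s)" "random_variable borel (X 0)"
        using s by (auto intro!: random_variable_X)
      have "measure (distr M borel (X s)) {x. e < norm x} = prob {\<omega> \<in> space M. e < norm (X s \<omega>)}"
        by (subst measure_distr) (auto intro!: arg_cong[where f = prob])
      also have "\<dots> = prob {\<omega> \<in> space M. e < norm (X s \<omega> - X 0 \<omega>)}"
        by (rule finite_measure_eq_AE) (use starts_at_0 in auto)
      finally show ?thesis .
    qed
    then show "\<forall>\<^sub>F s in at_right 0. prob {\<omega> \<in> space M. e < norm (X s \<omega> - X 0 \<omega>)} = measure (distr M borel (X s)) {x. e < norm x}"
      by (intro eventually_at_rightI[of 0 1]) auto
  qed
qed

end

lemma generator_eq: "has_generator_value \<mu> f g \<Longrightarrow> generator \<mu> f = g"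
  unfolding generator_def
proof (rule the_equality)
  fix h assume g: "has_generator_value \<mu> f g" and h: "has_generator_value \<mu> f h"
  have "h x = g x" for x
    by (rule tendsto_unique[OF trivial_limit_at_right_real tendsto_uniform_limitI tendsto_uniform_limitI])
       (use g h in \<open>auto simp: has_generator_value_def\<close>)
  then show "h = g" ..
qed

theorem proposition2p11:
  fixes p :: real
    and M :: "'w measure"
    and X :: "real \<Rightarrow> 'w \<Rightarrow> 'a::euclidean_space"
    and \<mu> :: "real \<Rightarrow> 'a measure"
    and \<phi> :: "real \<Rightarrow> ereal"
    and f :: "'a \<Rightarrow> real"
  assumes "1 < p"
    and "levy_process M X"
    and "\<And>t. 0 \<le> t \<Longrightarrow> \<mu> t = distr M borel (X t)"
    and "integrable (\<mu> 1) (\<lambda>x. norm x powr p)"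
    and "\<And>x. 0 \<le> x \<Longrightarrow> 0 \<le> \<phi> x"
    and "lower_semicontinuous_on {0..} \<phi>"
    and "ereal_convex_on {0..} \<phi>"
    and "mono_on {0..} \<phi>"
    and "\<not> \<phi> constant_on {0..}"
    and "\<phi> 0 = 0"
    and "ereal_convex_on {0..} (\<lambda>x. \<phi> (x powr (1 / p)))"
    and "f \<in> generator_domain \<mu>"
    and "f \<in> C01"
  shows "uniform_limit UNIV
           (\<lambda>t x. (pert_semigroup p \<phi> \<mu> t f x - f x) / t)
           (\<lambda>x. generator \<mu> f x + real_of_ereal (conjugate_fun \<phi> (norm (grad f x))))
           (at_right 0)"
proof -
  interpret levy_process M X by (fact assms(2))
  note mu = assms(3)
  have nonzero: "\<exists>x\<ge>0. 0 < \<phi> x"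
  proof (rule ccontr)
    assume "\<not> (\<exists>x\<ge>0. 0 < \<phi> x)"
    then have "\<phi> x = 0" if "0 \<le> x" for x using assms(5)[OF that] that by (metis order_le_less)
    then have "\<phi> constant_on {0..}" unfolding constant_on_def by auto
    with assms(9) show False by blast
  qed
  interpret wasserstein_perturbation p \<phi> \<mu>
  proof
    show "\<mu> t \<in> prob_moment p" if "0 \<le> t" "t \<le> 1" for t
      using marginal_moment[of p t] that assms(1,4) by (simp add: mu)
    show "((\<lambda>t. measure (\<mu> t) {x. e < norm x}) \<longlongrightarrow> 0) (at_right 0)" if "0 < e" for e
      by (rule Lim_transform_eventually[OF marginal_vanish[OF that]])
         (auto simp: mu intro!: eventually_at_rightI[of 0 1])
    show "distr (\<mu> s \<Otimes>\<^sub>M \<mu> t) borel (\<lambda>z. fst z + snd z) = \<mu> (s + t)" if "0 \<le> s" "0 \<le> t" "s + t \<le> 1" for s t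
      using marginal_add[OF that(1,2)] that by (simp add: mu)
  qed (use assms nonzero in auto)
  obtain g where g: "has_generator_value \<mu> f g" using assms(12) unfolding generator_domain_def by blast
  show ?thesis
    using pert_semigroup_generator[OF assms(13) g] unfolding generator_eq[OF g] phistar_def .
qed

end
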